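(* Let $X$ and $Y$ be non-trivial complex Banach spaces, let $1\le p<\infty$ and $1/p+1/q=1$. Suppose that $(R(t))_{t>0}\subseteq L(X,Y)$ is a strongly continuous operator family and $\sum_{k=0}^\infty\|R(\cdot)\|_{L^q[k,k+1]}<\infty$. If $f\in S^pQ\text{-}AAP(\mathbb{R}:X)$, then the function $\mathbf{F}:\mathbb{R}\to Y$ defined by $\mathbf{F}(t):=\int_{-\infty}^tR(t-s)f(s)\,ds$, $t\in\mathbb{R}$, belongs to $Q\text{-}AAP(\mathbb{R}:Y)$.
   Context: $L(X,Y)$ is the space of continuous linear mappings from $X$ into $Y$, and $\|R(\cdot)\|_{L^q[k,k+1]}$ is the $L^q[k,k+1]$-norm of $s\mapsto\|R(s)\|_{L(X,Y)}$ ($q=\infty$ if $p=1$). Let $I=\mathbb{R}$ and let $Z$ be a Banach space. $Q\text{-}AAP(I:Z)$ (quasi-asymptotically almost periodic functions) is the set of bounded continuous $f:I\to Z$ such that for each $\epsilon>0$ there exists a finite number $L(\epsilon)>0$ such that any interval $I'\subseteq I$ of length $L(\epsilon)$ contains at least one number $\tau\in I'$ for which there exists a finite number $M(\epsilon,\tau)>0$ with $\|f(t+\tau)-f(t)\|\le\epsilon$ for all $t\in I$ with $|t|\ge M(\epsilon,\tau)$. $S^pQ\text{-}AAP(I:Z)$ (Stepanov $p$-quasi-asymptotically almost periodic functions) is the set of $f\in L^p_{loc}(I:Z)$ with $\sup_{t\in I}\int_t^{t+1}\|f(s)\|^p\,ds<\infty$ such that for each $\epsilon>0$ there exists a finite number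 $L(\epsilon)>0$ such that any interval $I'\subseteq I$ of length $L(\epsilon)$ contains at least one number $\tau\in I'$ for which there exists a finite number $M(\epsilon,\tau)>0$ with $\int_t^{t+1}\|f(s+\tau)-f(s)\|^p\,ds\le\epsilon^p$ for all $t\in I$ with $|t|\ge M(\epsilon,\tau)$. *)

theory Defs
  imports "HOL-Analysis.Analysis" "HOL-Probability.Essential_Supremum"
begin

section \<open>Complex Banach spaces\<close>

class complex_banach = banach +
  fixes scaleC :: "complex \<Rightarrow> 'a \<Rightarrow> 'a" (infixr \<open>*\<^sub>C\<close> 75)
  assumes scaleC_add_right: "a *\<^sub>C (x + y) = a *\<^sub>C x + a *\<^sub>C y"
    and scaleC_add_left: "(a + b) *\<^sub>C x = a *\<^sub>C x + b *\<^sub>C x"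
    and scaleC_scaleC: "a *\<^sub>C b *\<^sub>C x = (a * b) *\<^sub>C x"
    and scaleC_one: "1 *\<^sub>C x = x"
    and scaleC_of_real: "complex_of_real r *\<^sub>C x = r *\<^sub>R x"
    and norm_scaleC: "norm (a *\<^sub>C x) = cmod a * norm x"

instantiation complex :: complex_banach
begin

definition scaleC_complex :: "complex \<Rightarrow> complex \<Rightarrow> complex" where
  "scaleC_complex a x = a * x"

instance
  by standard
    (simp_all add: scaleC_complex_def algebra_simps norm_mult scaleR_conv_of_real)

end

text \<open>The space $L(X,Y)$. The library type of bounded linear maps is that of the real-linear ones;
  the operator norm does not depend on the choice of scalars.\<close>

definition bounded_clinear_ops :: "('a::complex_banach \<Rightarrow>\<^sub>L 'b::complex_banach) set" where
  "bounded_clinear_ops =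
     {T. \<forall>c x. blinfun_apply T (c *\<^sub>C x) = c *\<^sub>C blinfun_apply T x}"


section \<open>Bochner integral in arbitrary Banach spaces\<close>

text \<open>The Bochner integral of the library is restricted to second-countable target spaces.
  The definitions below repeat the library's construction with Borel measurability replaced by
  strong (Bochner) measurability, so that non-separable Banach spaces are covered. They are meant
  for complete measures: only there is an almost-everywhere limit of simple functions itself
  measurable.\<close>

definition strongly_measurable :: "'s measure \<Rightarrow> ('s \<Rightarrow> 'b::real_normed_vector) \<Rightarrow> bool" where
  "strongly_measurable M f \<longleftrightarrow>
     (\<exists>u :: nat \<Rightarrow> 's \<Rightarrow> 'b. (\<forall>i. simple_function M (u i)) \<and> (AE x in M. (\<lambda>i. u i x) \<longlonglongrightarrow> f x))"

definition bochner_has_integral ::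
    "'s measure \<Rightarrow> ('s \<Rightarrow> 'b::real_normed_vector) \<Rightarrow> 'b \<Rightarrow> bool" where
  "bochner_has_integral M f y \<longleftrightarrow>
     strongly_measurable M f \<and>
     (\<exists>u :: nat \<Rightarrow> 's \<Rightarrow> 'b. (\<forall>i. Bochner_Integration.simple_bochner_integrable M (u i)) \<and>
        (\<lambda>i. \<integral>\<^sup>+x. ennreal (norm (f x - u i x)) \<partial>M) \<longlonglongrightarrow> 0 \<and>
        (\<lambda>i. Bochner_Integration.simple_bochner_integral M (u i)) \<longlonglongrightarrow> y)"

definition bochner_integrable :: "'s measure \<Rightarrow> ('s \<Rightarrow> 'b::real_normed_vector) \<Rightarrow> bool" where
  "bochner_integrable M f \<longleftrightarrow> (\<exists>y. bochner_has_integral M f y)"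

definition bochner_integral :: "'s measure \<Rightarrow> ('s \<Rightarrow> 'b::real_normed_vector) \<Rightarrow> 'b" where
  "bochner_integral M f =
     (if bochner_integrable M f then (THE y. bochner_has_integral M f y) else 0)"


section \<open>Lebesgue norms\<close>

definition ennreal_powr :: "ennreal \<Rightarrow> real \<Rightarrow> ennreal" where
  "ennreal_powr x a = (if x = \<infinity> then \<infinity> else ennreal (enn2real x powr a))"

text \<open>The $L^q(A)$-norm, $1 \le q \le \infty$, of a real function on the line.\<close>

definition Lq_norm :: "ennreal \<Rightarrow> real set \<Rightarrow> (real \<Rightarrow> real) \<Rightarrow> ennreal" where
  "Lq_norm q A h =
     (if q = \<infinity> then esssup (lebesgue_on A) (\<lambda>s. ennreal \<bar>h s\<bar>)
      else ennreal_powr (\<integral>\<^sup>+s. ennreal (\<bar>h s\<bar> powr enn2real q) \<partial>lebesgue_on A) (1 / enn2real q))"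


section \<open>Quasi-asymptotically almost periodic functions on the line\<close>

definition QAAP :: "(real \<Rightarrow> 'b::banach) set" where
  "QAAP = {f. bounded (range f) \<and> continuous_on UNIV f \<and>
     (\<forall>\<epsilon>>0. \<exists>L>0. \<forall>J. is_interval J \<and> emeasure lborel J = ennreal L \<longrightarrow>
        (\<exists>\<tau>\<in>J. \<exists>M>0. \<forall>t. \<bar>t\<bar> \<ge> M \<longrightarrow> norm (f (t + \<tau>) - f t) \<le> \<epsilon>))}"

definition Lp_loc :: "real \<Rightarrow> (real \<Rightarrow> 'b::banach) set" where
  "Lp_loc p = {f. strongly_measurable lebesgue f \<and>
     (\<forall>K. compact K \<longrightarrow> (\<integral>\<^sup>+s. ennreal (norm (f s) powr p) \<partial>lebesgue_on K) < \<infinity>)}"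

definition Stepanov_QAAP :: "real \<Rightarrow> (real \<Rightarrow> 'b::banach) set" where
  "Stepanov_QAAP p = {f. f \<in> Lp_loc p \<and>
     (SUP t. \<integral>\<^sup>+s. ennreal (norm (f s) powr p) \<partial>lebesgue_on {t..t+1}) < \<infinity> \<and>
     (\<forall>\<epsilon>>0. \<exists>L>0. \<forall>J. is_interval J \<and> emeasure lborel J = ennreal L \<longrightarrow>
        (\<exists>\<tau>\<in>J. \<exists>M>0. \<forall>t. \<bar>t\<bar> \<ge> M \<longrightarrow>
           (\<integral>\<^sup>+s. ennreal (norm (f (s + \<tau>) - f s) powr p) \<partial>lebesgue_on {t..t+1})
             \<le> ennreal (\<epsilon> powr p)))}"

end

theory Submission
  imports Defs
begin

text \<open>Translating the variable gives
  \<open>F (t + \<tau>) - F t = \<integral>\<^bsub>s<t\<^esub> R (t - s) (f (s + \<tau>) - f s) ds\<close>. Hoelder's inequality on the unit intervals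
  \<open>[t - k - 1, t - k]\<close> bounds its norm by \<open>\<Sum>k. N k * d k\<close>, where \<open>N k\<close> is the norm of \<open>R\<close> in \<open>L\<^sup>q[k, k + 1]\<close> and
  \<open>d k\<close> the norm of \<open>f (\<cdot> + \<tau>) - f\<close> in \<open>L\<^sup>p[t - k - 1, t - k]\<close>. The \<open>d k\<close> are uniformly bounded and the \<open>N k\<close>
  are summable, so it suffices to make finitely many \<open>d k\<close> small: for \<open>\<tau> \<rightarrow> 0\<close> they are small because
  translations are continuous in \<open>L\<^sup>p\<close>, and for an almost period \<open>\<tau>\<close> of \<open>f\<close> they are small once \<open>\<bar>t\<bar>\<close> is large.
  Measurability of \<open>s \<mapsto> R (t - s) (f s)\<close> for merely strongly continuous \<open>R\<close> rests on the uniform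
  boundedness principle.\<close>

subsection \<open>Strong measurability\<close>

text \<open>Two obstacles shape the argument. The spaces may be non-separable, so vector-valued
  measurability always means an almost-everywhere limit of simple functions. And \<open>R\<close> is
  only strongly continuous: its norm enters as a scalar function, Borel because it is a supremum of
  continuous functions on the positive half-line. At 0 and to the left nothing is known about
  \<open>R\<close>, so the point 0 of \<open>[0, 1]\<close> is discarded as a null set. Errors in
  the mean are tracked through integrals of p-th powers, with the crude factor
  \<open>2 powr p\<close> in place of Minkowski's inequality; only constants are affected.
  Continuity and almost periodicity of \<open>F\<close> come from one statement in which the number
  \<open>K\<close> of relevant unit intervals and the tolerance \<open>d\<close> depend on
  \<open>e\<close> alone, neither on \<open>t\<close> nor on the translation. This uniformity lets
  an almost period of \<open>f\<close> for the tolerance \<open>d\<close> serve for \<open>F\<close>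
  as well.\<close>

lemma (in complete_measure) borel_measurable_AE_eq:
  fixes f g :: "'a \<Rightarrow> 'b::topological_space"
  assumes g: "g \<in> borel_measurable M" and eq: "AE x in M. f x = g x"
  shows "f \<in> borel_measurable M"
proof (rule measurableI)
  fix A :: "'b set" assume "A \<in> sets borel"
  show "f -` A \<inter> space M \<in> sets M"
  proof (rule in_sets_AE)
    show "AE x in M. x \<in> g -` A \<inter> space M \<longleftrightarrow> x \<in> f -` A \<inter> space M"
      using eq by eventually_elim auto
    show "g -` A \<inter> space M \<in> sets M"
      using g \<open>A \<in> sets borel\<close> by (rule measurable_sets)
  qed auto
qed auto

text \<open>Null sets of the restriction are the Lebesgue null sets inside \<open>S\<close>, so
  completeness is inherited. It is needed on the half-lines over which the convolution is
  integrated.\<close>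

lemma complete_measure_lebesgue_on:
  assumes "S \<in> sets lebesgue"
  shows "complete_measure (lebesgue_on S)"
proof
  fix A B :: "'a set" assume "B \<subseteq> A" "A \<in> null_sets (lebesgue_on S)"
  moreover from this have "A \<in> null_sets lebesgue" "A \<subseteq> S"
    using assms by (auto simp: null_sets_restrict_space)
  ultimately have "B \<in> sets lebesgue" "B \<subseteq> S"
    using completion.complete by auto
  then show "B \<in> sets (lebesgue_on S)"
    using assms by (auto simp: sets_restrict_space_iff)
qed

lemma strongly_measurable_simple:
  "simple_function M u \<Longrightarrow> strongly_measurable M u"
  unfolding strongly_measurable_def by (intro exI[of _ "\<lambda>_. u"]) auto

lemma strongly_measurable_diff:
  assumes "strongly_measurable M f" "strongly_measurable M g"
  shows "strongly_measurable M (\<lambda>x. f x - g x)"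
proof -
  obtain u v where u: "\<And>i. simple_function M (u i)" "AE x in M. (\<lambda>i. u i x) \<longlonglongrightarrow> f x"
    and v: "\<And>i. simple_function M (v i)" "AE x in M. (\<lambda>i. v i x) \<longlonglongrightarrow> g x"
    using assms unfolding strongly_measurable_def by blast
  have "AE x in M. (\<lambda>i. u i x - v i x) \<longlonglongrightarrow> f x - g x"
    using u(2) v(2) by eventually_elim (rule tendsto_diff)
  moreover have "simple_function M (\<lambda>x. u i x - v i x)" for i
    using u(1) v(1) by (rule simple_function_compose2)
  ultimately show ?thesis
    unfolding strongly_measurable_def by (intro exI[of _ "\<lambda>i x. u i x - v i x"]) auto
qed

lemma strongly_measurable_restrict:
  assumes "strongly_measurable lebesgue f" "S \<in> sets lebesgue"
  shows "strongly_measurable (lebesgue_on S) f"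
proof -
  obtain u where u: "\<And>i. simple_function lebesgue (u i)" "AE x in lebesgue. (\<lambda>i. u i x) \<longlonglongrightarrow> f x"
    using assms unfolding strongly_measurable_def by blast
  have "simple_function (lebesgue_on S) (u i)" for i
  proof -
    have "u i \<in> measurable lebesgue (count_space UNIV)"
      using u(1) by (rule measurable_simple_function)
    then have "u i \<in> measurable (lebesgue_on S) (count_space UNIV)"
      by (rule measurable_restrict_space1)
    moreover have "finite (u i ` S)"
      using simple_functionD(1)[OF u(1)] by (rule finite_subset[rotated]) auto
    ultimately show ?thesis
      unfolding simple_function_def by (auto intro: measurable_sets simp: measurable_def)
  qed
  moreover have "AE x in lebesgue_on S. (\<lambda>i. u i x) \<longlonglongrightarrow> f x"
    using u(2) assms(2) by (auto simp: AE_restrict_space_iff)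
  ultimately show ?thesis
    unfolding strongly_measurable_def by blast
qed

text \<open>Almost everywhere the norm is the limit of the norms of simple functions. The term
  \<open>lim\<close> is Borel even where the sequence diverges, and completeness permits the change
  on the exceptional null set.\<close>

lemma strongly_measurable_norm:
  assumes "complete_measure M" "strongly_measurable M f"
  shows "(\<lambda>x. norm (f x)) \<in> borel_measurable M"
proof -
  interpret complete_measure M by fact
  obtain u where u: "\<And>i. simple_function M (u i)" "AE x in M. (\<lambda>i. u i x) \<longlonglongrightarrow> f x"
    using assms unfolding strongly_measurable_def by blast
  have "simple_function M (\<lambda>x. norm (u i x))" for i
    using u(1) by (rule simple_function_compose1)
  then have [measurable]: "(\<lambda>x. norm (u i x)) \<in> borel_measurable M" for i
    by (rule borel_measurable_simple_function)
  show ?thesis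
  proof (rule borel_measurable_AE_eq)
    show "(\<lambda>x. lim (\<lambda>i. norm (u i x))) \<in> borel_measurable M"
      by measurable
    show "AE x in M. norm (f x) = lim (\<lambda>i. norm (u i x))"
      using u(2) by eventually_elim (metis limI tendsto_norm)
  qed
qed

subsection \<open>Approximation by simple functions\<close>

text \<open>Cutting the approximants off where they exceed twice the limit makes the convergence dominated.\<close>

lemma strongly_measurable_dominated_approx:
  assumes M: "complete_measure M" and f: "strongly_measurable M f"
  obtains v where "\<And>i. simple_function M (v i)" "\<And>i x. norm (v i x) \<le> 2 * norm (f x)"
    "AE x in M. (\<lambda>i. v i x) \<longlonglongrightarrow> f x"
proof -
  obtain u where u: "\<And>i. simple_function M (u i)" "AE x in M. (\<lambda>i. u i x) \<longlonglongrightarrow> f x"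
    using f unfolding strongly_measurable_def by blast
  define v where "v i x = (if norm (u i x) \<le> 2 * norm (f x) then u i x else 0)" for i x
  have "simple_function M (\<lambda>x. norm (u i x))" for i
    using u(1) by (rule simple_function_compose1)
  then have [measurable]: "(\<lambda>x. norm (u i x)) \<in> borel_measurable M" for i
    by (rule borel_measurable_simple_function)
  have [measurable]: "(\<lambda>x. norm (f x)) \<in> borel_measurable M"
    using M f by (rule strongly_measurable_norm)
  have 1: "simple_function M (v i)" for i
    unfolding v_def by (intro simple_function_If u(1)) auto
  have "AE x in M. (\<lambda>i. v i x) \<longlonglongrightarrow> f x"
    using u(2)
  proof eventually_elim
    case (elim x)
    \<comment> \<open>At a zero of \<open>f\<close> the cutoff annihilates every approximant.
      Elsewhere \<open>2 * norm (f x)\<close> lies strictly above the limit of the norms, so the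
      cutoff is eventually inactive.\<close>
    show ?case
    proof (cases "f x = 0")
      case True
      then have "v i x = 0" for i by (auto simp: v_def)
      then show ?thesis using True by simp
    next
      case False
      then have "norm (f x) < 2 * norm (f x)" by simp
      with tendsto_norm[OF elim] have "\<forall>\<^sub>F i in sequentially. norm (u i x) < 2 * norm (f x)"
        by (rule order_tendstoD)
      then have "\<forall>\<^sub>F i in sequentially. u i x = v i x"
        by eventually_elim (simp add: v_def)
      then show ?thesis using elim by (rule Lim_transform_eventually[rotated])
    qed
  qed
  moreover have "norm (v i x) \<le> 2 * norm (f x)" for i x
    by (auto simp: v_def)
  ultimately show ?thesis using 1 that by blast
qed

text \<open>Dominated convergence: since \<open>norm (v i x) \<le> 2 * norm (f x)\<close>, the error
  is at most \<open>3 * norm (f x)\<close>. The case \<open>p = 1\<close> constructs the integral;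
  general \<open>p\<close> serves the continuity of translations.\<close>

lemma strongly_measurable_Lp_approx:
  fixes p :: real
  assumes M: "complete_measure M" and f: "strongly_measurable M f" and p: "0 < p"
    and fin: "(\<integral>\<^sup>+x. ennreal (norm (f x) powr p) \<partial>M) < \<infinity>"
  obtains v where "\<And>i. simple_function M (v i)" "\<And>i x. norm (v i x) \<le> 2 * norm (f x)"
    "(\<lambda>i. \<integral>\<^sup>+x. ennreal (norm (f x - v i x) powr p) \<partial>M) \<longlonglongrightarrow> 0"
proof -
  obtain v where v: "\<And>i. simple_function M (v i)" "\<And>i x. norm (v i x) \<le> 2 * norm (f x)"
    "AE x in M. (\<lambda>i. v i x) \<longlonglongrightarrow> f x"
    using strongly_measurable_dominated_approx[OF M f] by blast
  have [measurable]: "(\<lambda>x. norm (f x)) \<in> borel_measurable M"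
    using M f by (rule strongly_measurable_norm)
  have [measurable]: "(\<lambda>x. norm (f x - v i x)) \<in> borel_measurable M" for i
    by (intro strongly_measurable_norm[OF M] strongly_measurable_diff f
        strongly_measurable_simple v)
  have "(\<lambda>i. \<integral>\<^sup>+x. ennreal (norm (f x - v i x) powr p) \<partial>M) \<longlonglongrightarrow> (\<integral>\<^sup>+x. 0 \<partial>M)"
  proof (rule nn_integral_dominated_convergence[where w = "\<lambda>x. ennreal (3 powr p) * ennreal (norm (f x) powr p)"])
    show "AE x in M. ennreal (norm (f x - v j x) powr p) \<le> ennreal (3 powr p) * ennreal (norm (f x) powr p)" for j
    proof (rule AE_I2)
      fix x
      have "norm (f x - v j x) \<le> 3 * norm (f x)"
        using norm_triangle_ineq4[of "f x" "v j x"] v(2)[of j x] by linarith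
      then have "norm (f x - v j x) powr p \<le> (3 * norm (f x)) powr p"
        using p by (intro powr_mono2) auto
      then show "ennreal (norm (f x - v j x) powr p) \<le> ennreal (3 powr p) * ennreal (norm (f x) powr p)"
        by (simp add: powr_mult flip: ennreal_mult)
    qed
    show "(\<integral>\<^sup>+x. ennreal (3 powr p) * ennreal (norm (f x) powr p) \<partial>M) < \<infinity>"
      using fin by (simp add: nn_integral_cmult ennreal_mult_less_top)
    show "AE x in M. (\<lambda>i. ennreal (norm (f x - v i x) powr p)) \<longlonglongrightarrow> 0"
      using v(3)
    proof eventually_elim
      case (elim x)
      have "(\<lambda>i. norm (f x - v i x)) \<longlonglongrightarrow> 0"
        using tendsto_norm[OF tendsto_diff[OF tendsto_const[of "f x"] elim]] by simp
      then have "(\<lambda>i. norm (f x - v i x) powr p) \<longlonglongrightarrow> 0 powr p"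
        using p by (intro tendsto_powr2) auto
      then show ?case by (simp add: tendsto_ennrealI flip: ennreal_0)
    qed
  qed measurable
  with v(1,2) show ?thesis by (intro that) auto
qed

subsection \<open>The Bochner integral\<close>

text \<open>For the simple approximants this is the triangle inequality, up to an error that tends
  to 0. Applied to the difference of two integrals of one function, whose integrand vanishes, it
  also gives uniqueness.\<close>

lemma bochner_has_integral_bound:
  assumes M: "complete_measure M" and f: "bochner_has_integral M f y"
  shows "ennreal (norm y) \<le> (\<integral>\<^sup>+x. ennreal (norm (f x)) \<partial>M)"
proof -
  obtain u where u: "\<And>i. Bochner_Integration.simple_bochner_integrable M (u i)"
    "(\<lambda>i. \<integral>\<^sup>+x. ennreal (norm (f x - u i x)) \<partial>M) \<longlonglongrightarrow> 0"
    "(\<lambda>i. Bochner_Integration.simple_bochner_integral M (u i)) \<longlonglongrightarrow> y"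
    and sm: "strongly_measurable M f"
    using f unfolding bochner_has_integral_def by blast
  have sf: "simple_function M (u i)" for i
    using u(1)[of i] by (auto elim: simple_bochner_integrable.cases)
  have [measurable]: "(\<lambda>x. norm (f x)) \<in> borel_measurable M"
    using M sm by (rule strongly_measurable_norm)
  have [measurable]: "(\<lambda>x. norm (f x - u i x)) \<in> borel_measurable M" for i
    by (intro strongly_measurable_norm[OF M] strongly_measurable_diff sm
        strongly_measurable_simple sf)
  have le: "ennreal (norm (Bochner_Integration.simple_bochner_integral M (u i)))
    \<le> (\<integral>\<^sup>+x. ennreal (norm (f x)) \<partial>M) + (\<integral>\<^sup>+x. ennreal (norm (f x - u i x)) \<partial>M)" for i
  proof -
    have n: "Bochner_Integration.simple_bochner_integrable M (\<lambda>x. norm (u i x))"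
      using simple_bochner_integrable_compose2[where p="\<lambda>x y. norm x", OF _ u(1) u(1)] by simp
    have "ennreal (norm (Bochner_Integration.simple_bochner_integral M (u i)))
      \<le> ennreal (Bochner_Integration.simple_bochner_integral M (\<lambda>x. norm (u i x)))"
      by (intro ennreal_leI simple_bochner_integral_norm_bound u)
    also have "\<dots> = (\<integral>\<^sup>+x. ennreal (norm (u i x)) \<partial>M)"
      by (intro simple_bochner_integral_eq_nn_integral n) auto
    also have "\<dots> \<le> (\<integral>\<^sup>+x. ennreal (norm (f x)) + ennreal (norm (f x - u i x)) \<partial>M)"
    proof (rule nn_integral_mono)
      fix x
      have "norm (u i x) \<le> norm (f x) + norm (f x - u i x)"
        using norm_triangle_sub[of "u i x" "f x"] by (simp add: norm_minus_commute)
      then show "ennreal (norm (u i x)) \<le> ennreal (norm (f x)) + ennreal (norm (f x - u i x))"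
        by (simp flip: ennreal_plus)
    qed
    also have "\<dots> = (\<integral>\<^sup>+x. ennreal (norm (f x)) \<partial>M) + (\<integral>\<^sup>+x. ennreal (norm (f x - u i x)) \<partial>M)"
      by (rule nn_integral_add) auto
    finally show ?thesis .
  qed
  have lim1: "(\<lambda>i. ennreal (norm (Bochner_Integration.simple_bochner_integral M (u i)))) \<longlonglongrightarrow> ennreal (norm y)"
    using u(3) by (intro tendsto_intros)
  have lim2: "(\<lambda>i. (\<integral>\<^sup>+x. ennreal (norm (f x)) \<partial>M) + (\<integral>\<^sup>+x. ennreal (norm (f x - u i x)) \<partial>M))
    \<longlonglongrightarrow> (\<integral>\<^sup>+x. ennreal (norm (f x)) \<partial>M) + 0"
    using u(2) by (intro tendsto_intros)
  have "ennreal (norm y) \<le> (\<integral>\<^sup>+x. ennreal (norm (f x)) \<partial>M) + 0"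
    by (rule LIMSEQ_le[OF lim1 lim2]) (use le in blast)
  then show ?thesis by simp
qed

lemma bochner_has_integral_diff:
  assumes M: "complete_measure M"
    and f: "bochner_has_integral M f y" and g: "bochner_has_integral M g z"
  shows "bochner_has_integral M (\<lambda>x. f x - g x) (y - z)"
proof -
  obtain u where u: "\<And>i. Bochner_Integration.simple_bochner_integrable M (u i)"
    "(\<lambda>i. \<integral>\<^sup>+x. ennreal (norm (f x - u i x)) \<partial>M) \<longlonglongrightarrow> 0"
    "(\<lambda>i. Bochner_Integration.simple_bochner_integral M (u i)) \<longlonglongrightarrow> y"
    and fm: "strongly_measurable M f"
    using f unfolding bochner_has_integral_def by blast
  obtain v where v: "\<And>i. Bochner_Integration.simple_bochner_integrable M (v i)"
    "(\<lambda>i. \<integral>\<^sup>+x. ennreal (norm (g x - v i x)) \<partial>M) \<longlonglongrightarrow> 0"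
    "(\<lambda>i. Bochner_Integration.simple_bochner_integral M (v i)) \<longlonglongrightarrow> z"
    and gm: "strongly_measurable M g"
    using g unfolding bochner_has_integral_def by blast
  have sf: "simple_function M (u i)" "simple_function M (v i)" for i
    using u(1)[of i] v(1)[of i] by (auto elim: simple_bochner_integrable.cases)
  have [measurable]: "(\<lambda>x. norm (f x - u i x)) \<in> borel_measurable M"
    "(\<lambda>x. norm (g x - v i x)) \<in> borel_measurable M" for i
    by (intro strongly_measurable_norm[OF M] strongly_measurable_diff fm gm
        strongly_measurable_simple sf)+
  have le: "(\<integral>\<^sup>+x. ennreal (norm (f x - g x - (u i x - v i x))) \<partial>M)
    \<le> (\<integral>\<^sup>+x. ennreal (norm (f x - u i x)) \<partial>M) + (\<integral>\<^sup>+x. ennreal (norm (g x - v i x)) \<partial>M)" for i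
  proof -
    have "(\<integral>\<^sup>+x. ennreal (norm (f x - g x - (u i x - v i x))) \<partial>M)
      \<le> (\<integral>\<^sup>+x. ennreal (norm (f x - u i x)) + ennreal (norm (g x - v i x)) \<partial>M)"
    proof (rule nn_integral_mono)
      fix x
      have "norm (f x - g x - (u i x - v i x)) \<le> norm (f x - u i x) + norm (g x - v i x)"
        using norm_triangle_ineq4[of "f x - u i x" "g x - v i x"] by (simp add: algebra_simps)
      then show "ennreal (norm (f x - g x - (u i x - v i x)))
        \<le> ennreal (norm (f x - u i x)) + ennreal (norm (g x - v i x))"
        by (simp flip: ennreal_plus)
    qed
    then show ?thesis by (simp add: nn_integral_add)
  qed
  have lim0: "(\<lambda>i. (\<integral>\<^sup>+x. ennreal (norm (f x - u i x)) \<partial>M)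
      + (\<integral>\<^sup>+x. ennreal (norm (g x - v i x)) \<partial>M)) \<longlonglongrightarrow> 0"
    using tendsto_add[OF u(2) v(2)] by simp
  have lim: "(\<lambda>i. \<integral>\<^sup>+x. ennreal (norm (f x - g x - (u i x - v i x))) \<partial>M) \<longlonglongrightarrow> 0"
    by (rule tendsto_sandwich[OF _ _ tendsto_const lim0]) (use le in auto)
  show ?thesis
    unfolding bochner_has_integral_def
  proof (intro conjI exI[of _ "\<lambda>i x. u i x - v i x"] allI)
    show "strongly_measurable M (\<lambda>x. f x - g x)"
      using fm gm by (rule strongly_measurable_diff)
    show "Bochner_Integration.simple_bochner_integrable M (\<lambda>x. u i x - v i x)" for i
      using simple_bochner_integrable_compose2[where p="(-)", OF _ u(1) v(1)] by simp
    show "(\<lambda>i. Bochner_Integration.simple_bochner_integral M (\<lambda>x. u i x - v i x)) \<longlonglongrightarrow> y - z"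
      using tendsto_diff[OF u(3) v(3)] by (simp add: simple_bochner_integral_diff u(1) v(1))
  qed (fact lim)
qed

lemma bochner_has_integral_unique:
  assumes "complete_measure M" "bochner_has_integral M f y" "bochner_has_integral M f z"
  shows "y = z"
  using bochner_has_integral_bound[OF assms(1) bochner_has_integral_diff[OF assms]] by simp

lemma bochner_has_integral_integral:
  assumes "complete_measure M" "bochner_integrable M f"
  shows "bochner_has_integral M f (bochner_integral M f)"
proof -
  obtain y where y: "bochner_has_integral M f y"
    using assms(2) unfolding bochner_integrable_def by blast
  then have "bochner_has_integral M f (THE y. bochner_has_integral M f y)"
    by (rule theI) (rule bochner_has_integral_unique[OF assms(1) _ y])
  then show ?thesis using assms(2) by (simp add: bochner_integral_def)
qed

text \<open>Completeness of the target space enters here: the integrals of two approximants differ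
  by at most the sum of their \<open>L1\<close> errors, hence form a Cauchy sequence.\<close>

lemma bochner_integrableI:
  fixes f :: "'s \<Rightarrow> 'b::banach"
  assumes M: "complete_measure M" and f: "strongly_measurable M f"
    and fin: "(\<integral>\<^sup>+x. ennreal (norm (f x)) \<partial>M) < \<infinity>"
  shows "bochner_integrable M f"
proof -
  obtain v where v: "\<And>i. simple_function M (v i)" "\<And>i x. norm (v i x) \<le> 2 * norm (f x)"
    "(\<lambda>i. \<integral>\<^sup>+x. ennreal (norm (f x - v i x) powr 1) \<partial>M) \<longlonglongrightarrow> 0"
    by (rule strongly_measurable_Lp_approx[OF M f, of 1]) (use fin in auto)
  then have lim: "(\<lambda>i. \<integral>\<^sup>+x. ennreal (norm (f x - v i x)) \<partial>M) \<longlonglongrightarrow> 0"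
    by simp
  have [measurable]: "(\<lambda>x. norm (f x)) \<in> borel_measurable M"
    using M f by (rule strongly_measurable_norm)
  have [measurable]: "(\<lambda>x. norm (f x - v i x)) \<in> borel_measurable M" for i
    by (intro strongly_measurable_norm[OF M] strongly_measurable_diff f
        strongly_measurable_simple v)
  have int: "Bochner_Integration.simple_bochner_integrable M (v i)" for i
  proof (rule simple_bochner_integrableI_bounded[OF v(1)])
    have "(\<integral>\<^sup>+x. ennreal (norm (v i x)) \<partial>M) \<le> (\<integral>\<^sup>+x. 2 * ennreal (norm (f x)) \<partial>M)"
    proof (rule nn_integral_mono)
      fix x
      have "ennreal (norm (v i x)) \<le> ennreal (2 * norm (f x))"
        by (intro ennreal_leI v)
      then show "ennreal (norm (v i x)) \<le> 2 * ennreal (norm (f x))"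
        by (simp add: ennreal_mult)
    qed
    also have "\<dots> < \<infinity>"
      using fin by (simp add: nn_integral_cmult ennreal_mult_less_top)
    finally show "(\<integral>\<^sup>+x. ennreal (norm (v i x)) \<partial>M) < \<infinity>" .
  qed
  define a where "a i = (\<integral>\<^sup>+x. ennreal (norm (f x - v i x)) \<partial>M)" for i
  have diff: "ennreal (norm (Bochner_Integration.simple_bochner_integral M (v i) - Bochner_Integration.simple_bochner_integral M (v j))) \<le> a i + a j" for i j
  proof -
    have n: "Bochner_Integration.simple_bochner_integrable M (\<lambda>x. norm (v i x - v j x))"
      using simple_bochner_integrable_compose2[where p="\<lambda>x y. norm (x - y)", OF _ int int] by simp
    have d: "Bochner_Integration.simple_bochner_integrable M (\<lambda>x. v i x - v j x)"
      using simple_bochner_integrable_compose2[where p="(-)", OF _ int int] by simp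
    have "ennreal (norm (Bochner_Integration.simple_bochner_integral M (v i) - Bochner_Integration.simple_bochner_integral M (v j)))
      \<le> ennreal (Bochner_Integration.simple_bochner_integral M (\<lambda>x. norm (v i x - v j x)))"
      using simple_bochner_integral_norm_bound[OF d]
      by (intro ennreal_leI) (simp add: simple_bochner_integral_diff int)
    also have "\<dots> = (\<integral>\<^sup>+x. ennreal (norm (v i x - v j x)) \<partial>M)"
      by (intro simple_bochner_integral_eq_nn_integral n) auto
    also have "\<dots> \<le> (\<integral>\<^sup>+x. ennreal (norm (f x - v i x)) + ennreal (norm (f x - v j x)) \<partial>M)"
    proof (rule nn_integral_mono)
      fix x
      have "norm (v i x - v j x) \<le> norm (f x - v i x) + norm (f x - v j x)"
        by (metis add.commute norm_minus_commute dist_norm dist_triangle)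
      then show "ennreal (norm (v i x - v j x)) \<le> ennreal (norm (f x - v i x)) + ennreal (norm (f x - v j x))"
        by (simp flip: ennreal_plus)
    qed
    finally show ?thesis by (simp add: nn_integral_add a_def)
  qed
  have "Cauchy (\<lambda>i. Bochner_Integration.simple_bochner_integral M (v i))"
  proof (rule metric_CauchyI)
    fix e :: real assume "0 < e"
    then have "\<forall>\<^sub>F i in sequentially. a i < ennreal (e / 2)"
      using lim unfolding a_def by (intro order_tendstoD) auto
    then obtain N where N: "\<And>i. i \<ge> N \<Longrightarrow> a i < ennreal (e / 2)"
      by (auto simp: eventually_sequentially)
    show "\<exists>N. \<forall>i\<ge>N. \<forall>j\<ge>N. dist (Bochner_Integration.simple_bochner_integral M (v i)) (Bochner_Integration.simple_bochner_integral M (v j)) < e"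
    proof (intro exI[of _ N] allI impI)
      fix i j assume "N \<le> i" "N \<le> j"
      then have "a i + a j < ennreal (e / 2) + ennreal (e / 2)"
        by (intro add_strict_mono N)
      with diff[of i j] have "ennreal (norm (Bochner_Integration.simple_bochner_integral M (v i) - Bochner_Integration.simple_bochner_integral M (v j)))
        < ennreal (e / 2) + ennreal (e / 2)"
        by (rule le_less_trans)
      also have "\<dots> = ennreal e"
        using \<open>0 < e\<close> by (simp flip: ennreal_plus)
      finally show "dist (Bochner_Integration.simple_bochner_integral M (v i)) (Bochner_Integration.simple_bochner_integral M (v j)) < e"
        by (simp add: dist_norm ennreal_less_iff)
    qed
  qed
  then obtain y where "(\<lambda>i. Bochner_Integration.simple_bochner_integral M (v i)) \<longlonglongrightarrow> y"
    using Cauchy_convergent_iff convergent_def by blast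
  then show ?thesis
    unfolding bochner_integrable_def bochner_has_integral_def using f int lim by blast
qed

subsection \<open>Invariance under measure preserving maps\<close>

text \<open>The equation \<open>distr M N T = N\<close> ensures that the null set where convergence
  fails pulls back to a null set.\<close>

lemma strongly_measurable_comp:
  assumes T: "T \<in> measurable M N" "distr M N T = N" and f: "strongly_measurable N f"
  shows "strongly_measurable M (\<lambda>x. f (T x))"
proof -
  obtain u where u: "\<And>i. simple_function N (u i)" "AE x in N. (\<lambda>i. u i x) \<longlonglongrightarrow> f x"
    using f unfolding strongly_measurable_def by blast
  have "AE x in distr M N T. (\<lambda>i. u i x) \<longlonglongrightarrow> f x"
    unfolding T(2) by (rule u(2))
  then have "AE x in M. (\<lambda>i. u i (T x)) \<longlonglongrightarrow> f (T x)"
    by (rule AE_distrD[OF T(1)])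
  moreover have "simple_function M (\<lambda>x. u i (T x))" for i
    using T(1) u(1) by (rule simple_function_comp)
  ultimately show ?thesis
    unfolding strongly_measurable_def by (intro exI[of _ "\<lambda>i x. u i (T x)"]) auto
qed

lemma simple_bochner_integral_comp:
  assumes T: "T \<in> measurable M N" "distr M N T = N" and u: "Bochner_Integration.simple_bochner_integrable N u"
  shows "Bochner_Integration.simple_bochner_integrable M (\<lambda>x. u (T x))"
    and "Bochner_Integration.simple_bochner_integral M (\<lambda>x. u (T x)) = Bochner_Integration.simple_bochner_integral N u"
proof -
  have sf: "simple_function N u"
    using u by (auto elim: simple_bochner_integrable.cases)
  then have [measurable]: "u \<in> measurable N (count_space UNIV)"
    by (rule measurable_simple_function)
  have pre: "emeasure M {x \<in> space M. P (u (T x))} = emeasure N {x \<in> space N. P (u x)}" for P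
  proof -
    have "emeasure N {x \<in> space N. P (u x)} = emeasure (distr M N T) {x \<in> space N. P (u x)}"
      unfolding T(2) ..
    also have "\<dots> = emeasure M (T -` {x \<in> space N. P (u x)} \<inter> space M)"
      using simple_functionD(2)[OF sf, of "Collect P"]
      by (intro emeasure_distr[OF T(1)]) (simp add: vimage_def Int_def conj_commute)
    also have "T -` {x \<in> space N. P (u x)} \<inter> space M = {x \<in> space M. P (u (T x))}"
      using measurable_space[OF T(1)] by auto
    finally show ?thesis by simp
  qed
  show "Bochner_Integration.simple_bochner_integrable M (\<lambda>x. u (T x))"
  proof
    show "simple_function M (\<lambda>x. u (T x))"
      using T(1) sf by (rule simple_function_comp)
    show "emeasure M {x \<in> space M. u (T x) \<noteq> 0} \<noteq> \<infinity>"
      using u pre[of "\<lambda>y. y \<noteq> 0"] by (auto elim: simple_bochner_integrable.cases)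
  qed
  have "Bochner_Integration.simple_bochner_integral N u = (\<Sum>y\<in>u ` space N. measure M {x \<in> space M. u (T x) = y} *\<^sub>R y)"
    unfolding simple_bochner_integral_def measure_def using pre[of "\<lambda>z. z = y" for y] by simp
  also have "\<dots> = (\<Sum>y\<in>(\<lambda>x. u (T x)) ` space M. measure M {x \<in> space M. u (T x) = y} *\<^sub>R y)"
  \<comment> \<open>\<open>T\<close> need not be onto, so \<open>u\<close> may take values that its
    composition with \<open>T\<close> omits. The level sets of these values are empty in
    \<open>M\<close>.\<close>
  proof (rule sum.mono_neutral_right)
    show "finite (u ` space N)" using sf by (rule simple_functionD)
    show "(\<lambda>x. u (T x)) ` space M \<subseteq> u ` space N"
      using measurable_space[OF T(1)] by auto
    show "\<forall>y\<in>u ` space N - (\<lambda>x. u (T x)) ` space M. measure M {x \<in> space M. u (T x) = y} *\<^sub>R y = 0"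
    proof
      fix y assume "y \<in> u ` space N - (\<lambda>x. u (T x)) ` space M"
      then have "{x \<in> space M. u (T x) = y} = {}" by (force simp: image_iff)
      then show "measure M {x \<in> space M. u (T x) = y} *\<^sub>R y = 0" by (simp only: measure_empty) simp
    qed
  qed
  finally show "Bochner_Integration.simple_bochner_integral M (\<lambda>x. u (T x)) = Bochner_Integration.simple_bochner_integral N u"
    by (simp add: simple_bochner_integral_def)
qed

text \<open>Intended for translations: \<open>F (t + h)\<close> and \<open>F t\<close> are integrals
  over different half-lines and can be subtracted only after one is carried onto the other.\<close>

lemma bochner_has_integral_comp:
  assumes N: "complete_measure N" and T: "T \<in> measurable M N" "distr M N T = N"
    and f: "bochner_has_integral N f y"
  shows "bochner_has_integral M (\<lambda>x. f (T x)) y"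
proof -
  obtain u where u: "\<And>i. Bochner_Integration.simple_bochner_integrable N (u i)"
    "(\<lambda>i. \<integral>\<^sup>+x. ennreal (norm (f x - u i x)) \<partial>N) \<longlonglongrightarrow> 0"
    "(\<lambda>i. Bochner_Integration.simple_bochner_integral N (u i)) \<longlonglongrightarrow> y"
    and sm: "strongly_measurable N f"
    using f unfolding bochner_has_integral_def by blast
  have sf: "simple_function N (u i)" for i
    using u(1)[of i] by (auto elim: simple_bochner_integrable.cases)
  have [measurable]: "(\<lambda>x. norm (f x - u i x)) \<in> borel_measurable N" for i
    by (intro strongly_measurable_norm[OF N] strongly_measurable_diff sm
        strongly_measurable_simple sf)
  have "(\<integral>\<^sup>+x. ennreal (norm (f x - u i x)) \<partial>N) = (\<integral>\<^sup>+x. ennreal (norm (f (T x) - u i (T x))) \<partial>M)" for i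
  proof -
    have "(\<integral>\<^sup>+x. ennreal (norm (f x - u i x)) \<partial>N)
      = (\<integral>\<^sup>+x. ennreal (norm (f x - u i x)) \<partial>(distr M N T))"
      unfolding T(2) ..
    also have "\<dots> = (\<integral>\<^sup>+x. ennreal (norm (f (T x) - u i (T x))) \<partial>M)"
      by (rule nn_integral_distr[OF T(1)]) (simp add: T(2))
    finally show ?thesis .
  qed
  then have "(\<lambda>i. \<integral>\<^sup>+x. ennreal (norm (f (T x) - u i (T x))) \<partial>M) \<longlonglongrightarrow> 0"
    using u(2) by simp
  then show ?thesis
    unfolding bochner_has_integral_def
    using strongly_measurable_comp[OF T sm] simple_bochner_integral_comp[OF T u(1)] u(3)
    by (intro conjI exI[of _ "\<lambda>i x. u i (T x)"]) auto
qed

subsection \<open>Strongly continuous operator families\<close>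

text \<open>Banach-Steinhaus by Baire's theorem: the closed sets \<open>V m\<close> cover the space,
  so one of them contains a ball.\<close>

lemma uniform_boundedness:
  fixes T :: "nat \<Rightarrow> 'a::banach \<Rightarrow>\<^sub>L 'b::real_normed_vector"
  assumes "\<And>x. bounded (range (\<lambda>n. T n x))"
  obtains B where "\<And>n. norm (T n) \<le> B"
proof -
  define V where "V m = {x. \<forall>n. norm (T n x) \<le> real m}" for m :: nat
  have closed: "closed (V m)" for m
    unfolding V_def by (intro closed_Collect_all closed_Collect_le continuous_intros)
  have "x \<in> \<Union> (range V)" for x
  proof -
    obtain b where "\<And>n. norm (T n x) \<le> b"
      using assms[of x] unfolding bounded_iff by auto
    moreover obtain m :: nat where "b \<le> real m"
      using real_arch_simple by blast
    ultimately have "x \<in> V m"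
      unfolding V_def using order_trans by blast
    then show ?thesis by blast
  qed
  then have UN: "\<Union> (range V) = UNIV" by blast
  have "\<exists>m. interior (V m) \<noteq> {}"
  proof (rule ccontr)
    assume "\<not> ?thesis"
    then have "euclidean interior_of \<Union> (range V) = {}"
      using closed by (intro Baire_category_alt disjI1 completely_metrizable_space_euclidean) auto
    then show False using UN by simp
  qed
  then obtain m x0 where "x0 \<in> interior (V m)" by blast
  then obtain r where r: "r > 0" "cball x0 r \<subseteq> V m"
    unfolding mem_interior_cball by blast
  \<comment> \<open>A vector \<open>z\<close> of norm \<open>r\<close> is the difference of
    \<open>x0 + z\<close> and \<open>x0\<close>, both in \<open>V m\<close>; hence the factor 2, and
    scaling gives the division by \<open>r\<close>.\<close>
  have "norm (T n) \<le> 2 * real m / r" for n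
  proof (rule norm_blinfun_bound)
    fix x :: 'a
    show "norm (T n x) \<le> 2 * real m / r * norm x"
    proof (cases "x = 0")
      case False
      define z where "z = (r / norm x) *\<^sub>R x"
      have "norm z = r" using False r by (simp add: z_def)
      then have "x0 + z \<in> V m" "x0 \<in> V m"
        using r by (auto simp: subset_iff dist_norm)
      then have "norm (T n (x0 + z)) \<le> real m" "norm (T n x0) \<le> real m"
        by (auto simp: V_def)
      moreover have "T n (x0 + z) - T n x0 = T n z"
        by (simp add: blinfun.add_right)
      ultimately have "norm (T n z) \<le> 2 * real m"
        using norm_triangle_ineq4[of "T n (x0 + z)" "T n x0"] by simp
      then have "r / norm x * norm (T n x) \<le> 2 * real m"
        using r by (simp add: z_def blinfun.scaleR_right)
      then show ?thesis using r False by (simp add: field_simps)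
    qed (simp add: blinfun.zero_right)
  qed (use r in auto)
  then show ?thesis using that by blast
qed

text \<open>Strong convergence bounds the operator norms along the sequence, so the error
  \<open>y n - z\<close> in the argument is damped uniformly in the operator.\<close>

lemma tendsto_blinfun_apply_strong:
  fixes T :: "nat \<Rightarrow> 'a::banach \<Rightarrow>\<^sub>L 'b::real_normed_vector"
  assumes T: "\<And>x. (\<lambda>n. T n x) \<longlonglongrightarrow> blinfun_apply S x" and y: "y \<longlonglongrightarrow> z"
  shows "(\<lambda>n. T n (y n)) \<longlonglongrightarrow> blinfun_apply S z"
proof -
  have "bounded (range (\<lambda>n. T n x))" for x
    using T by (rule convergent_imp_bounded)
  then obtain B where B: "\<And>n. norm (T n) \<le> B"
    using uniform_boundedness by blast
  have "(\<lambda>n. T n (y n - z)) \<longlonglongrightarrow> 0"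
  proof (rule Lim_null_comparison)
    show "\<forall>\<^sub>F n in sequentially. norm (T n (y n - z)) \<le> B * norm (y n - z)"
      by (intro always_eventually allI order_trans[OF norm_blinfun] mult_right_mono B) simp
    have "(\<lambda>n. y n - z) \<longlonglongrightarrow> 0" using y by (simp add: LIM_zero)
    then show "(\<lambda>n. B * norm (y n - z)) \<longlonglongrightarrow> 0"
      by (intro tendsto_mult_right_zero tendsto_norm_zero)
  qed
  from tendsto_add[OF this T[of z]] show ?thesis
    by (simp add: blinfun.diff_right)
qed

text \<open>Both ingredients are discretised at once: \<open>g\<close> by simple functions, and
  \<open>s\<close> by rounding down to a multiple of \<open>1 / real (Suc n)\<close>. Rounding down
  keeps \<open>t - d n s \<ge> t - s > 0\<close>, inside the domain of strong continuity.\<close>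

lemma strongly_measurable_convolution_integrand:
  fixes R :: "real \<Rightarrow> 'a::banach \<Rightarrow>\<^sub>L 'b::real_normed_vector"
  assumes R: "\<And>x. continuous_on {0<..} (\<lambda>t. blinfun_apply (R t) x)"
    and g: "strongly_measurable (lebesgue_on {..<t}) g"
  shows "strongly_measurable (lebesgue_on {..<t}) (\<lambda>s. R (t - s) (g s))"
proof -
  let ?M = "lebesgue_on {..<t}"
  obtain u where u: "\<And>i. simple_function ?M (u i)" "AE s in ?M. (\<lambda>i. u i s) \<longlonglongrightarrow> g s"
    using g unfolding strongly_measurable_def by blast
  define d :: "nat \<Rightarrow> real \<Rightarrow> real" where "d n s = \<lfloor>real (Suc n) * s\<rfloor> / real (Suc n)" for n s
  \<comment> \<open>The cutoff at \<open>real n\<close> leaves only finitely many rounded values, as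
    simple functions require; each fixed \<open>s\<close> is eventually unaffected.\<close>
  define e where "e n s = (if \<bar>s\<bar> \<le> real n then d n s else 0)" for n s
  define w where "w n s = (if \<bar>s\<bar> \<le> real n then R (t - e n s) (u n s) else 0)" for n s
  have e: "simple_function ?M (e n)" for n
  proof (rule simple_function_borel_measurable)
    show "e n \<in> borel_measurable ?M"
      unfolding e_def d_def
      by (intro measurable_restrict_space1 measurable_completion) measurable
    let ?I = "{- (int (Suc n) * int n) - 1 .. int (Suc n) * int n}"
    have floor_mem: "\<lfloor>x\<rfloor> \<in> {- z - 1..z}" if "x \<le> of_int z" "- of_int z \<le> x" for x :: real and z :: int
      using that by (simp add: floor_le_iff le_floor_iff)
    have "e n ` space ?M \<subseteq> insert 0 ((\<lambda>k. real_of_int k / real (Suc n)) ` ?I)"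
    proof (rule image_subsetI)
      fix s
      have "\<lfloor>real (Suc n) * s\<rfloor> \<in> ?I" if "\<bar>s\<bar> \<le> real n"
      proof -
        have "\<bar>real (Suc n) * s\<bar> \<le> real (Suc n) * real n"
          unfolding abs_mult using that by (intro mult_mono) auto
        then have "real (Suc n) * s \<le> of_int (int (Suc n) * int n)"
          "- of_int (int (Suc n) * int n) \<le> real (Suc n) * s"
          unfolding of_int_mult of_int_of_nat_eq by linarith+
        then show ?thesis by (rule floor_mem)
      qed
      then show "e n s \<in> insert 0 ((\<lambda>k. real_of_int k / real (Suc n)) ` ?I)"
        unfolding e_def d_def by auto
    qed
    then show "finite (e n ` space ?M)"
      by (rule finite_subset) auto
  qed
  have w: "simple_function ?M (w n)" for n
    unfolding w_def
  proof (rule simple_function_If)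
    show "simple_function ?M (\<lambda>s. R (t - e n s) (u n s))"
      by (rule simple_function_compose2[OF e u(1)])
    show "{s \<in> space ?M. \<bar>s\<bar> \<le> real n} \<in> sets ?M"
      by (auto simp: sets_restrict_space_iff)
  qed auto
  have "AE s in ?M. (\<lambda>n. w n s) \<longlonglongrightarrow> R (t - s) (g s)"
    using u(2) AE_space
  proof eventually_elim
    case (elim s)
    then have s: "s < t" by simp
    have d_le: "d n s \<le> s" for n
      unfolding d_def using of_int_floor_le[of "real (Suc n) * s"]
      by (simp add: divide_le_eq mult.commute)
    have d_ge: "s - 1 / real (Suc n) \<le> d n s" for n
    proof -
      have "real (Suc n) * s - 1 \<le> \<lfloor>real (Suc n) * s\<rfloor>" by linarith
      then have "(real (Suc n) * s - 1) / real (Suc n) \<le> d n s"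
        unfolding d_def by (intro divide_right_mono) auto
      then show ?thesis by (simp add: diff_divide_distrib)
    qed
    have "(\<lambda>n. d n s) \<longlonglongrightarrow> s"
    proof (rule tendsto_sandwich[OF _ _ _ tendsto_const])
      show "(\<lambda>n. s - 1 / real (Suc n)) \<longlonglongrightarrow> s"
        using tendsto_diff[OF tendsto_const LIMSEQ_inverse_real_of_nat, of s]
        by (simp add: inverse_eq_divide)
    qed (use d_le d_ge in auto)
    then have lim: "(\<lambda>n. t - d n s) \<longlonglongrightarrow> t - s" by (intro tendsto_intros)
    have "(\<lambda>n. R (t - d n s) (u n s)) \<longlonglongrightarrow> R (t - s) (g s)"
    proof (rule tendsto_blinfun_apply_strong)
      fix x
      have "t - d n s \<in> {0<..}" for n using d_le[of n] s by simp
      then show "(\<lambda>n. R (t - d n s) x) \<longlonglongrightarrow> R (t - s) x"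
        using s by (intro continuous_on_tendsto_compose[OF R lim]) auto
    qed (rule elim)
    moreover obtain m where "\<bar>s\<bar> \<le> real m" using real_arch_simple by blast
    then have "\<forall>\<^sub>F n in sequentially. R (t - d n s) (u n s) = w n s"
      unfolding eventually_sequentially w_def e_def
      by (intro exI[of _ m]) auto
    ultimately show ?case by (rule Lim_transform_eventually)
  qed
  with w show ?thesis unfolding strongly_measurable_def by blast
qed

text \<open>Lower semicontinuity: for \<open>a \<ge> 0\<close>, \<open>a < norm (R u)\<close> holds
  iff some \<open>x\<close> satisfies \<open>a * norm x < norm (R u x)\<close>, an open condition on
  \<open>u > 0\<close> for each \<open>x\<close>. The union over all \<open>x\<close> is
  uncountable, but it is a union of open sets.\<close>

lemma borel_measurable_norm_strongly_continuous:
  fixes R :: "real \<Rightarrow> 'a::banach \<Rightarrow>\<^sub>L 'b::real_normed_vector"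
  assumes R: "\<And>x. continuous_on {0<..} (\<lambda>t. blinfun_apply (R t) x)"
  shows "(\<lambda>u. if u > 0 then norm (R u) else 0) \<in> borel_measurable borel"
    (is "?f \<in> _")
proof (rule borel_measurableI_greater)
  fix a :: real
  show "{u \<in> space borel. a < ?f u} \<in> sets borel"
  proof (cases "a < 0")
    case True
    then have "{u \<in> space borel. a < ?f u} = UNIV"
      by (auto intro: less_le_trans)
    then show ?thesis by simp
  next
    case False
    have *: "(\<exists>x. a * norm x < norm (R u x)) \<longleftrightarrow> a < norm (R u)" for u
    proof
      assume "a < norm (R u)"
      then show "\<exists>x. a * norm x < norm (R u x)"
        using norm_blinfun_bound[of a "R u"] False by (force simp: not_less)
    next
      assume "\<exists>x. a * norm x < norm (R u x)"
      then obtain x where x: "a * norm x < norm (R u x)" ..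
      also have "\<dots> \<le> norm (R u) * norm x" by (rule norm_blinfun)
      finally show "a < norm (R u)"
        by (simp add: mult_less_cancel_right)
    qed
    have "{u \<in> space borel. a < ?f u} = (\<Union>x. {0<..} \<inter> (\<lambda>u. R u x) -` {y. a * norm x < norm y})"
      using False * by auto
    also have "open \<dots>"
      by (intro open_UN ballI continuous_open_preimage R open_Collect_less continuous_intros)
    finally show ?thesis by simp
  qed
qed

subsection \<open>Hoelder's inequality\<close>

text \<open>Young's inequality is applied to \<open>a x / X\<close> and \<open>b x / Y\<close> and
  then integrated. A vanishing \<open>X\<close> or \<open>Y\<close> is split off, because the
  normalisation divides by it.\<close>

lemma nn_integral_Holder:
  fixes p q X Y :: real
  assumes pq: "1 < p" "1 < q" "1 / p + 1 / q = 1"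
    and [measurable]: "a \<in> borel_measurable M" "b \<in> borel_measurable M"
    and nonneg: "\<And>x. 0 \<le> a x" "\<And>x. 0 \<le> b x" "0 \<le> X" "0 \<le> Y"
    and a: "(\<integral>\<^sup>+x. ennreal (a x powr q) \<partial>M) \<le> ennreal (X powr q)"
    and b: "(\<integral>\<^sup>+x. ennreal (b x powr p) \<partial>M) \<le> ennreal (Y powr p)"
  shows "(\<integral>\<^sup>+x. ennreal (a x * b x) \<partial>M) \<le> ennreal (X * Y)"
proof -
  consider "X = 0" | "Y = 0" | "X > 0" "Y > 0" using nonneg by fastforce
  then show ?thesis
  proof cases
    case 1
    then have "(\<integral>\<^sup>+x. ennreal (a x powr q) \<partial>M) = 0" using a pq by simp
    then have "AE x in M. ennreal (a x powr q) = 0" by (subst (asm) nn_integral_0_iff_AE) auto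
    then have "AE x in M. ennreal (a x * b x) = 0"
      by eventually_elim (auto simp: ennreal_eq_0_iff)
    then show ?thesis by (subst nn_integral_0_iff_AE[THEN iffD2]) auto
  next
    case 2
    then have "(\<integral>\<^sup>+x. ennreal (b x powr p) \<partial>M) = 0" using b pq by simp
    then have "AE x in M. ennreal (b x powr p) = 0" by (subst (asm) nn_integral_0_iff_AE) auto
    then have "AE x in M. ennreal (a x * b x) = 0"
      by eventually_elim (auto simp: ennreal_eq_0_iff)
    then show ?thesis by (subst nn_integral_0_iff_AE[THEN iffD2]) auto
  next
    case 3
    \<comment> \<open>The weights come from multiplying Young's inequality by \<open>X * Y\<close>.
      After integration the two terms contribute at most \<open>X * Y / q\<close> and
      \<open>X * Y / p\<close>, which sum to \<open>X * Y\<close>.\<close>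
    define \<alpha> where "\<alpha> = X * Y / (q * X powr q)"
    define \<beta> where "\<beta> = X * Y / (p * Y powr p)"
    have pos: "\<alpha> \<ge> 0" "\<beta> \<ge> 0" using 3 pq by (auto simp: \<alpha>_def \<beta>_def)
    have le: "a x * b x \<le> \<alpha> * a x powr q + \<beta> * b x powr p" for x
    proof -
      have "(a x / X) * (b x / Y) \<le> (a x / X) powr q / q + (b x / Y) powr p / p"
        using pq 3 nonneg by (intro Youngs_inequality) auto
      then have "(X * Y) * ((a x / X) * (b x / Y)) \<le> (X * Y) * ((a x / X) powr q / q + (b x / Y) powr p / p)"
        using 3 by (intro mult_left_mono) auto
      also have "\<dots> = \<alpha> * a x powr q + \<beta> * b x powr p"
        using 3 nonneg by (simp add: \<alpha>_def \<beta>_def powr_divide distrib_left mult.commute)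
      finally show ?thesis using 3 by simp
    qed
    have "(\<integral>\<^sup>+x. ennreal (a x * b x) \<partial>M)
      \<le> (\<integral>\<^sup>+x. ennreal \<alpha> * ennreal (a x powr q) + ennreal \<beta> * ennreal (b x powr p) \<partial>M)"
      using le pos by (intro nn_integral_mono) (auto simp flip: ennreal_mult ennreal_plus)
    also have "\<dots> = ennreal \<alpha> * (\<integral>\<^sup>+x. ennreal (a x powr q) \<partial>M)
        + ennreal \<beta> * (\<integral>\<^sup>+x. ennreal (b x powr p) \<partial>M)"
      by (simp add: nn_integral_add nn_integral_cmult)
    also have "\<dots> \<le> ennreal \<alpha> * ennreal (X powr q) + ennreal \<beta> * ennreal (Y powr p)"
      by (intro add_mono mult_left_mono a b) auto
    also have "\<dots> = ennreal (\<alpha> * X powr q + \<beta> * Y powr p)"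
      using pos by (simp add: ennreal_mult ennreal_plus)
    also have "\<alpha> * X powr q + \<beta> * Y powr p = X * Y * (1 / p + 1 / q)"
      using 3 pq(1,2) by (simp add: \<alpha>_def \<beta>_def distrib_left)
    finally show ?thesis using pq by simp
  qed
qed

text \<open>The equation is read in \<open>ennreal\<close>, where \<open>1 / \<infinity> = 0\<close>
  and \<open>1 / 0 = \<infinity>\<close>. Thus \<open>p = 1\<close> forces
  \<open>q = \<infinity>\<close>, while \<open>p > 1\<close> rules out both 0 and \<infinity> for
  \<open>q\<close>.\<close>

lemma conjugate_exponent_cases:
  assumes "1 \<le> p" "1 / ennreal p + 1 / q = 1"
  obtains "p = 1" "q = \<infinity>"
    | r where "1 < p" "1 < r" "1 / p + 1 / r = 1" "q = ennreal r"
proof (cases "p = 1")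
  case True
  then have "1 + 1 / q = 1 + 0" using assms by simp
  then have "1 / q = 0" by (simp only: ennreal_add_left_cancel) auto
  then have "q = \<infinity>"
    by (cases q) (auto simp: divide_ennreal ennreal_eq_0_iff ennreal_divide_eq_0_iff)
  with True that(1) show ?thesis by blast
next
  case False
  with assms have p: "1 < p" by simp
  have 1: "1 / ennreal p = ennreal (1 / p)"
    using p divide_ennreal[of 1 p] by simp
  show ?thesis
  proof (cases q)
    case top
    then show ?thesis using assms(2) p 1 by (simp add: ennreal_1[symmetric] del: ennreal_1)
  next
    case (real r)
    have "r \<noteq> 0"
    proof
      assume "r = 0"
      then show False using assms(2) real by (simp add: divide_ennreal_def)
    qed
    then have r: "0 < r" using real by simp
    have "1 / q = ennreal (1 / r)"
      using r real divide_ennreal[of 1 r] by simp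
    then have "ennreal (1 / p + 1 / r) = ennreal 1"
      using assms(2) 1 p r by simp
    then have eq: "1 / p + 1 / r = 1" using p r by (subst (asm) ennreal_inj) auto
    then have "1 / r < 1" using p by (smt (verit) zero_less_divide_1_iff)
    then have "1 < r" using r by simp
    with eq p real show ?thesis using that(2) by blast
  qed
qed

text \<open>Unites the essential supremum bound (\<open>p = 1\<close>) with Hoelder's inequality
  (\<open>p > 1\<close>), so that the exponents need not be distinguished afterwards.\<close>

lemma nn_integral_mult_le_Lq_norm:
  fixes p X Y :: real and q :: ennreal
  assumes p: "1 \<le> p" and pq: "1 / ennreal p + 1 / q = 1"
    and [measurable]: "a \<in> borel_measurable (lebesgue_on A)" "b \<in> borel_measurable (lebesgue_on A)"
    and nonneg: "\<And>x. 0 \<le> a x" "\<And>x. 0 \<le> b x" "0 \<le> X" "0 \<le> Y"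
    and a: "Lq_norm q A a = ennreal X"
    and b: "(\<integral>\<^sup>+x. ennreal (b x powr p) \<partial>lebesgue_on A) \<le> ennreal (Y powr p)"
  shows "(\<integral>\<^sup>+x. ennreal (a x * b x) \<partial>lebesgue_on A) \<le> ennreal (X * Y)"
  using p pq
proof (cases rule: conjugate_exponent_cases)
  case 1
  have "esssup (lebesgue_on A) (\<lambda>x. ennreal (a x)) = ennreal X"
    using a 1 nonneg by (simp add: Lq_norm_def)
  then have "AE x in lebesgue_on A. ennreal (a x) \<le> ennreal X"
    using esssup_AE[of "\<lambda>x. ennreal (a x)" "lebesgue_on A"] by simp
  then have "AE x in lebesgue_on A. ennreal (a x * b x) \<le> ennreal X * ennreal (b x)"
    by eventually_elim (use nonneg in \<open>auto simp: ennreal_mult intro: mult_right_mono\<close>)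
  then have "(\<integral>\<^sup>+x. ennreal (a x * b x) \<partial>lebesgue_on A) \<le> (\<integral>\<^sup>+x. ennreal X * ennreal (b x) \<partial>lebesgue_on A)"
    by (rule nn_integral_mono_AE)
  also have "\<dots> = ennreal X * (\<integral>\<^sup>+x. ennreal (b x powr p) \<partial>lebesgue_on A)"
    using 1 nonneg by (simp add: nn_integral_cmult)
  also have "\<dots> \<le> ennreal X * ennreal (Y powr p)"
    by (intro mult_left_mono b) simp
  also have "\<dots> = ennreal (X * Y)"
    using 1 nonneg by (simp add: ennreal_mult)
  finally show ?thesis .
next
  case (2 r)
  define I where "I = (\<integral>\<^sup>+x. ennreal (a x powr r) \<partial>lebesgue_on A)"
  have "ennreal_powr I (1 / r) = ennreal X"
    using a 2 nonneg by (simp add: Lq_norm_def I_def)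
  then have "I \<noteq> \<infinity>" and X: "ennreal (enn2real I powr (1 / r)) = ennreal X"
    by (auto simp: ennreal_powr_def split: if_splits)
  then have "enn2real I powr (1 / r) = X"
    using nonneg by (subst (asm) ennreal_inj) auto
  then have "X powr r = enn2real I"
    using 2 by (auto simp: powr_powr)
  then have "I = ennreal (X powr r)"
    using \<open>I \<noteq> \<infinity>\<close> by (simp add: less_top)
  then show ?thesis
    using 2 nonneg b by (intro nn_integral_Holder[of p r]) (auto simp: I_def)
qed

subsection \<open>Translations and reflections of the line\<close>

text \<open>Turns invariance on the whole space into invariance between a set and its preimage,
  which is the form required for domains of integration that move with \<open>t\<close>.\<close>

lemma distr_restrict_space_vimage:
  assumes T: "T \<in> measurable M M" "distr M M T = M" and A: "A \<in> sets M"
  shows "T \<in> measurable (restrict_space M (T -` A \<inter> space M)) (restrict_space M A)"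
    and "distr (restrict_space M (T -` A \<inter> space M)) (restrict_space M A) T = restrict_space M A"
proof -
  show meas: "T \<in> measurable (restrict_space M (T -` A \<inter> space M)) (restrict_space M A)"
    by (rule measurable_restrict_space3[OF T(1)]) auto
  have pre: "T -` A \<inter> space M \<in> sets M"
    using T(1) A by (rule measurable_sets)
  show "distr (restrict_space M (T -` A \<inter> space M)) (restrict_space M A) T = restrict_space M A"
    (is "?D = ?R")
  proof (rule measure_eqI)
    fix X assume "X \<in> sets ?D"
    then have X: "X \<in> sets ?R" "X \<in> sets M" "X \<subseteq> A"
      using A by (auto simp: sets_restrict_space_iff)
    have "emeasure ?D X = emeasure (restrict_space M (T -` A \<inter> space M)) (T -` X \<inter> space M)"
      using X(3) pre by (subst emeasure_distr[OF meas X(1)])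
        (auto simp: space_restrict_space intro!: arg_cong2[where f=emeasure])
    also have "\<dots> = emeasure M (T -` X \<inter> space M)"
      using X(3) pre by (intro emeasure_restrict_space) auto
    also have "\<dots> = emeasure (distr M M T) X"
      using T(1) X(2) by (simp add: emeasure_distr)
    also have "\<dots> = emeasure ?R X"
      unfolding T(2) using X A by (intro emeasure_restrict_space[symmetric]) auto
    finally show "emeasure ?D X = emeasure ?R X" .
  qed simp
qed

text \<open>An affine map scales Lebesgue measure by \<open>\<bar>c\<bar>\<close>. The values 1 and
  -1 of \<open>c\<close> give translations and reflections together.\<close>

lemma lebesgue_real_isometry:
  fixes c t :: real
  assumes "\<bar>c\<bar> = 1"
  shows "(\<lambda>s. t + c * s) \<in> lebesgue \<rightarrow>\<^sub>M lebesgue" "distr lebesgue lebesgue (\<lambda>s. t + c * s) = lebesgue"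
proof -
  have "c \<noteq> 0" using assms by auto
  then show "(\<lambda>s. t + c * s) \<in> lebesgue \<rightarrow>\<^sub>M lebesgue"
    using lebesgue_affine_measurable[of "\<lambda>x::real. c" t] by simp
  show "distr lebesgue lebesgue (\<lambda>s. t + c * s) = lebesgue"
    using lebesgue_real_affine[OF \<open>c \<noteq> 0\<close>, of t] assms by (simp add: density_1)
qed

lemma lebesgue_translation:
  fixes h :: real
  shows "(\<lambda>s. s + h) \<in> lebesgue \<rightarrow>\<^sub>M lebesgue" "distr lebesgue lebesgue (\<lambda>s. s + h) = lebesgue"
  using lebesgue_real_isometry[of 1 h] by (simp_all add: add.commute)

lemma nn_integral_lebesgue_on_isometry:
  fixes c t :: real
  assumes c: "\<bar>c\<bar> = 1" and A: "A \<in> sets lebesgue" and h: "h \<in> borel_measurable lebesgue"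
  shows "(\<integral>\<^sup>+s. h s \<partial>lebesgue_on A) = (\<integral>\<^sup>+s. h (t + c * s) \<partial>lebesgue_on ((\<lambda>s. t + c * s) -` A))"
proof -
  let ?T = "\<lambda>s. t + c * s"
  note T = distr_restrict_space_vimage[OF lebesgue_real_isometry[OF c, of t] A, simplified]
  have "(\<integral>\<^sup>+s. h s \<partial>lebesgue_on A) = (\<integral>\<^sup>+s. h s \<partial>distr (lebesgue_on (?T -` A)) (lebesgue_on A) ?T)"
    unfolding T(2) ..
  also have "\<dots> = (\<integral>\<^sup>+s. h (?T s) \<partial>lebesgue_on (?T -` A))"
    using h by (intro nn_integral_distr T(1)) (simp add: measurable_restrict_space1)
  finally show ?thesis .
qed

lemma nn_integral_lebesgue_on_translate:
  fixes a b t :: real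
  assumes "h \<in> borel_measurable lebesgue"
  shows "(\<integral>\<^sup>+s. h (s + t) \<partial>lebesgue_on {a..b}) = (\<integral>\<^sup>+s. h s \<partial>lebesgue_on {a + t..b + t})"
proof -
  have "(\<lambda>s. t + 1 * s) -` {a + t..b + t} = {a..b}" by auto
  then show ?thesis
    using nn_integral_lebesgue_on_isometry[of 1 "{a + t..b + t}" h t] assms by (simp add: add.commute)
qed

lemma nn_integral_lebesgue_on_reflect:
  fixes a b t :: real
  assumes "h \<in> borel_measurable lebesgue"
  shows "(\<integral>\<^sup>+s. h (t - s) \<partial>lebesgue_on {a..b}) = (\<integral>\<^sup>+s. h s \<partial>lebesgue_on {t - b..t - a})"
proof -
  have "(\<lambda>s. t + (-1) * s) -` {t - b..t - a} = {a..b}" by auto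
  then show ?thesis
    using nn_integral_lebesgue_on_isometry[of "-1" "{t - b..t - a}" h t] assms by simp
qed

subsection \<open>Continuity of translations in the mean\<close>

lemma tendsto_0_ennrealI:
  assumes "\<And>e. 0 < e \<Longrightarrow> \<forall>\<^sub>F x in G. f x \<le> ennreal e"
  shows "(f \<longlongrightarrow> 0) G"
proof (rule order_tendstoI)
  fix a :: ennreal assume "0 < a"
  then obtain b where b: "0 < b" "b < a" using dense by blast
  then obtain e where "b = ennreal e" "0 < e"
    by (cases b) (auto simp: top_unique less_top[symmetric] ennreal_less_zero_iff)
  with assms[of e] b show "\<forall>\<^sub>F x in G. f x < a"
    by (auto elim: eventually_mono)
qed auto

text \<open>Regularity yields a compact \<open>K\<close> inside and an open \<open>U\<close> around
  \<open>A\<close>, each missing \<open>A\<close> by measure below \<open>e / 4\<close>. The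
  distance \<open>d\<close> from \<open>K\<close> to the complement of \<open>U\<close> is positive,
  so a translation by less than \<open>d\<close> keeps \<open>K\<close> inside
  \<open>U\<close>.\<close>

lemma tendsto_emeasure_translation_diff:
  fixes A :: "real set"
  assumes A: "A \<in> sets lebesgue" "bounded A"
  shows "((\<lambda>h. emeasure lebesgue {s. (s + h \<in> A) \<noteq> (s \<in> A)}) \<longlongrightarrow> 0) (nhds 0)"
proof (rule tendsto_0_ennrealI)
  fix e :: real assume "0 < e"
  then have e4: "0 < e / 4" by simp
  obtain U where U: "open U" "A \<subseteq> U" "U - A \<in> lmeasurable" "emeasure lebesgue (U - A) < ennreal (e / 4)"
    using sets_lebesgue_outer_open[OF A(1) e4] by blast
  obtain K where K: "closed K" "K \<subseteq> A" "A - K \<in> lmeasurable" "emeasure lebesgue (A - K) < ennreal (e / 4)"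
    using sets_lebesgue_inner_closed[OF A(1) e4] by blast
  have "compact K"
    using K A(2) bounded_subset compact_eq_bounded_closed by blast
  moreover have "closed (- U)" "K \<inter> - U = {}" using U K by auto
  ultimately obtain d where d: "d > 0" "\<And>x y. x \<in> K \<Longrightarrow> y \<in> - U \<Longrightarrow> d \<le> dist x y"
    using separate_compact_closed by metis
  have "emeasure lebesgue {s. (s + h \<in> A) \<noteq> (s \<in> A)} \<le> ennreal e" if h: "\<bar>h\<bar> < d" for h
  proof -
    let ?T = "\<lambda>s. s + h"
    have shift: "?T -` X \<in> sets lebesgue" "emeasure lebesgue (?T -` X) = emeasure lebesgue X"
      if "X \<in> sets lebesgue" for X
      using lebesgue_translation[of h] that measurable_sets[of ?T lebesgue lebesgue X]
        emeasure_distr[of ?T lebesgue lebesgue X] by auto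
    have near: "s \<in> K \<Longrightarrow> s + h \<in> U" "s + h \<in> K \<Longrightarrow> s \<in> U" for s
      using d(2)[of s "s + h"] d(2)[of "s + h" s] h by (auto simp: dist_real_def)
    have sets: "A - K \<in> sets lebesgue" "U - A \<in> sets lebesgue"
      using K(3) U(3) by (auto simp: fmeasurable_def)
    \<comment> \<open>If \<open>s\<close> lies in \<open>A\<close> and \<open>s + h\<close> does
      not, then either \<open>s\<close> is in \<open>A - K\<close>, or \<open>s\<close> is in
      \<open>K\<close> and \<open>s + h\<close> in \<open>U - A\<close>. The opposite case is
      symmetric, which makes four sets of measure below \<open>e / 4\<close>.\<close>
    have "{s. (s + h \<in> A) \<noteq> (s \<in> A)}
      \<subseteq> ((A - K) \<union> ?T -` (U - A)) \<union> (?T -` (A - K) \<union> (U - A))"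
      using near by auto
    then have "emeasure lebesgue {s. (s + h \<in> A) \<noteq> (s \<in> A)}
      \<le> emeasure lebesgue (((A - K) \<union> ?T -` (U - A)) \<union> (?T -` (A - K) \<union> (U - A)))"
      by (rule emeasure_mono) (intro sets.Un sets shift)
    also have "\<dots> \<le> (emeasure lebesgue (A - K) + emeasure lebesgue (?T -` (U - A)))
        + (emeasure lebesgue (?T -` (A - K)) + emeasure lebesgue (U - A))"
      by (intro order_trans[OF emeasure_subadditive] add_mono emeasure_subadditive sets.Un sets shift)
    also have "\<dots> \<le> (ennreal (e / 4) + ennreal (e / 4)) + (ennreal (e / 4) + ennreal (e / 4))"
      unfolding shift(2)[OF sets(1)] shift(2)[OF sets(2)]
      by (intro add_mono less_imp_le[OF U(4)] less_imp_le[OF K(4)])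
    also have "\<dots> = ennreal ((e / 4 + e / 4) + (e / 4 + e / 4))"
      using e4 by (simp only: ennreal_plus add_nonneg_nonneg less_imp_le)
    also have "(e / 4 + e / 4) + (e / 4 + e / 4) = e"
      by simp
    finally show ?thesis .
  qed
  then show "\<forall>\<^sub>F h in nhds 0. emeasure lebesgue {s. (s + h \<in> A) \<noteq> (s \<in> A)} \<le> ennreal e"
    unfolding eventually_nhds_metric using d(1) by (auto simp: dist_real_def)
qed

text \<open>The increment at \<open>s\<close> is nonzero only if some nonzero value \<open>y\<close>
  is attained at exactly one of \<open>s\<close> and \<open>s + h\<close>, that is, for
  \<open>s\<close> in \<open>D y h\<close>. There it is at most \<open>2 * b\<close>, and finitely
  many \<open>y\<close> occur.\<close>

lemma tendsto_nn_integral_simple_translation_diff: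
  fixes v :: "real \<Rightarrow> 'a::real_normed_vector" and p :: real
  assumes v: "simple_function lebesgue v" and supp: "\<And>s. s \<notin> S \<Longrightarrow> v s = 0" "bounded S" and p: "0 < p"
  shows "((\<lambda>h. \<integral>\<^sup>+s. ennreal (norm (v (s + h) - v s) powr p) \<partial>lebesgue) \<longlongrightarrow> 0) (nhds 0)"
proof -
  \<comment> \<open>The value 0 is omitted because its level set is unbounded; a jump from or to 0
    is registered by the other, nonzero value.\<close>
  define Y where "Y = range v - {0}"
  have finY: "finite Y" and fin: "finite (range v)"
    using simple_functionD(1)[OF v] by (auto simp: Y_def)
  define b where "b = Max ((\<lambda>y. norm y) ` range v)"
  have b: "norm (v s) \<le> b" for s
    unfolding b_def using fin by (intro Max_ge) auto
  define C where "C = (2 * b) powr p"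
  define D where "D y h = {s. (s + h \<in> v -` {y}) \<noteq> (s \<in> v -` {y})}" for y h
  have vy: "v -` {y} \<in> sets lebesgue" for y
    using simple_functionD(2)[OF v, of "{y}"] by simp
  have D: "D y h \<in> sets lebesgue" for y h
  proof -
    have "(\<lambda>s. s + h) -` (v -` {y}) \<in> sets lebesgue"
      using measurable_sets[OF lebesgue_translation(1) vy] by simp
    moreover have "D y h = ((\<lambda>s. s + h) -` (v -` {y}) - v -` {y}) \<union> (v -` {y} - (\<lambda>s. s + h) -` (v -` {y}))"
      unfolding D_def by auto
    ultimately show ?thesis using vy by (auto intro!: sets.Un sets.Diff)
  qed
  have le: "(\<integral>\<^sup>+s. ennreal (norm (v (s + h) - v s) powr p) \<partial>lebesgue)
    \<le> (\<Sum>y\<in>Y. ennreal C * emeasure lebesgue (D y h))" for h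
  proof -
    have "ennreal (norm (v (s + h) - v s) powr p) \<le> (\<Sum>y\<in>Y. ennreal C * indicator (D y h) s)" for s
    proof (cases "v (s + h) = v s")
      case False
      then obtain y where y: "y \<in> Y" "s \<in> D y h"
        unfolding Y_def D_def by (cases "v s = 0") auto
      have "norm (v (s + h) - v s) \<le> 2 * b"
        using norm_triangle_ineq4[of "v (s + h)" "v s"] b[of s] b[of "s + h"] by linarith
      then have "ennreal (norm (v (s + h) - v s) powr p) \<le> ennreal C"
        unfolding C_def using p by (intro ennreal_leI powr_mono2) auto
      also have "\<dots> = (\<Sum>y\<in>{y}. ennreal C * indicator (D y h) s)"
        using y by simp
      also have "\<dots> \<le> (\<Sum>y\<in>Y. ennreal C * indicator (D y h) s)"
        using y finY by (intro sum_mono2) auto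
      finally show ?thesis .
    qed simp
    then have "(\<integral>\<^sup>+s. ennreal (norm (v (s + h) - v s) powr p) \<partial>lebesgue)
      \<le> (\<integral>\<^sup>+s. (\<Sum>y\<in>Y. ennreal C * indicator (D y h) s) \<partial>lebesgue)"
      by (intro nn_integral_mono)
    also have "\<dots> = (\<Sum>y\<in>Y. ennreal C * emeasure lebesgue (D y h))"
    proof (subst nn_integral_sum)
      show "(\<lambda>s. ennreal C * indicator (D y h) s) \<in> borel_measurable lebesgue" for y
        using D by simp
    qed (intro sum.cong refl nn_integral_cmult_indicator D)
    finally show ?thesis .
  qed
  have lim: "((\<lambda>h. \<Sum>y\<in>Y. ennreal C * emeasure lebesgue (D y h)) \<longlongrightarrow> (\<Sum>y\<in>Y. ennreal C * 0)) (nhds 0)"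
  proof (intro tendsto_sum ennreal_tendsto_cmult)
    fix y assume "y \<in> Y"
    then have "v -` {y} \<subseteq> S" using supp(1) by (auto simp: Y_def)
    then have "bounded (v -` {y})" using supp(2) bounded_subset by blast
    then show "((\<lambda>h. emeasure lebesgue (D y h)) \<longlongrightarrow> 0) (nhds 0)"
      unfolding D_def by (intro tendsto_emeasure_translation_diff vy)
  qed simp
  show ?thesis
    by (rule tendsto_sandwich[OF _ _ tendsto_const lim[simplified]]) (use le in auto)
qed

text \<open>The sum is at most twice the larger summand.\<close>

lemma powr_add_le:
  fixes x y p :: real
  assumes "0 \<le> x" "0 \<le> y" "0 < p"
  shows "(x + y) powr p \<le> 2 powr p * (x powr p + y powr p)"
proof -
  have "(x + y) powr p \<le> (2 * max x y) powr p"
    using assms by (intro powr_mono2) auto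
  also have "\<dots> = 2 powr p * max x y powr p"
    using assms by (simp add: powr_mult)
  also have "\<dots> \<le> 2 powr p * (x powr p + y powr p)"
    by (intro mult_left_mono) (auto simp: max_def)
  finally show ?thesis .
qed

lemma nn_integral_norm_add_powr_le:
  fixes f g :: "'s \<Rightarrow> 'a::real_normed_vector" and p :: real
  assumes [measurable]: "(\<lambda>x. norm (f x)) \<in> borel_measurable M" "(\<lambda>x. norm (g x)) \<in> borel_measurable M"
    and p: "0 < p"
  shows "(\<integral>\<^sup>+x. ennreal (norm (f x + g x) powr p) \<partial>M)
    \<le> ennreal (2 powr p) * ((\<integral>\<^sup>+x. ennreal (norm (f x) powr p) \<partial>M) + (\<integral>\<^sup>+x. ennreal (norm (g x) powr p) \<partial>M))"
proof -
  have "ennreal (norm (f x + g x) powr p)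
    \<le> ennreal (2 powr p) * (ennreal (norm (f x) powr p) + ennreal (norm (g x) powr p))" for x
  proof -
    have "norm (f x + g x) powr p \<le> (norm (f x) + norm (g x)) powr p"
      using p by (intro powr_mono2 norm_triangle_ineq) auto
    also have "\<dots> \<le> 2 powr p * (norm (f x) powr p + norm (g x) powr p)"
      using p by (intro powr_add_le) auto
    finally show ?thesis by (simp flip: ennreal_mult ennreal_plus)
  qed
  then have "(\<integral>\<^sup>+x. ennreal (norm (f x + g x) powr p) \<partial>M)
    \<le> (\<integral>\<^sup>+x. ennreal (2 powr p) * (ennreal (norm (f x) powr p) + ennreal (norm (g x) powr p)) \<partial>M)"
    by (rule nn_integral_mono)
  then show ?thesis by (simp add: nn_integral_cmult nn_integral_add)
qed

text \<open>With a simple \<open>w\<close> close to \<open>f\<close>, the increment splits into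
  \<open>f - w\<close> at \<open>s + h\<close>, the increment of \<open>w\<close>, and
  \<open>w - f\<close> at \<open>s\<close>. Translation invariance makes the first error as small as
  the last.\<close>

lemma tendsto_nn_integral_translation_diff:
  fixes f :: "real \<Rightarrow> 'a::real_normed_vector" and p :: real
  assumes f: "strongly_measurable lebesgue f" and supp: "\<And>s. s \<notin> S \<Longrightarrow> f s = 0" "bounded S" and p: "0 < p"
    and fin: "(\<integral>\<^sup>+s. ennreal (norm (f s) powr p) \<partial>lebesgue) < \<infinity>"
  shows "((\<lambda>h. \<integral>\<^sup>+s. ennreal (norm (f (s + h) - f s) powr p) \<partial>lebesgue) \<longlongrightarrow> 0) (nhds 0)"
proof (rule tendsto_0_ennrealI)
  fix e :: real assume e: "0 < e"
  note L = completion.complete_measure_axioms[of lborel]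
  obtain v where v: "\<And>i. simple_function lebesgue (v i)" "\<And>i x. norm (v i x) \<le> 2 * norm (f x)"
    "(\<lambda>i. \<integral>\<^sup>+x. ennreal (norm (f x - v i x) powr p) \<partial>lebesgue) \<longlonglongrightarrow> 0"
    using strongly_measurable_Lp_approx[OF L f p fin] by blast
  define k where "k = 2 powr p"
  \<comment> \<open>Two uses of the inequality with factor \<open>k = 2 powr p\<close> combine three
    errors of size \<open>d\<close> into \<open>k * (d + k * (d + d)) = c * d\<close>, which equals
    \<open>e\<close>.\<close>
  define c where "c = k * (1 + k * 2)"
  define d where "d = e / c"
  have k: "k > 0" by (simp add: k_def)
  then have c: "c > 0" by (simp add: c_def add_pos_pos)
  then have d: "d > 0" using e by (simp add: d_def)
  from v(3) d have "\<forall>\<^sub>F i in sequentially. (\<integral>\<^sup>+x. ennreal (norm (f x - v i x) powr p) \<partial>lebesgue) < ennreal d"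
    by (intro order_tendstoD) auto
  then obtain i where i: "(\<integral>\<^sup>+x. ennreal (norm (f x - v i x) powr p) \<partial>lebesgue) < ennreal d"
    by (auto simp: eventually_sequentially)
  define w where "w = v i"
  \<comment> \<open>The bound \<open>norm (v i x) \<le> 2 * norm (f x)\<close> confines the support
    of \<open>w\<close> to \<open>S\<close>.\<close>
  have w: "simple_function lebesgue w" "\<And>s. s \<notin> S \<Longrightarrow> w s = 0"
  proof -
    show "w s = 0" if "s \<notin> S" for s
      using v(2)[of i s] supp(1)[OF that] by (simp add: w_def)
  qed (simp add: w_def v)
  let ?n = "\<lambda>g. \<integral>\<^sup>+x. ennreal (norm (g x) powr p) \<partial>lebesgue"
  have fw: "strongly_measurable lebesgue (\<lambda>s. f s - w s)"
    by (intro strongly_measurable_diff f strongly_measurable_simple w)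
  have fwh: "strongly_measurable lebesgue (\<lambda>s. f (s + h) - w (s + h))" for h
    by (rule strongly_measurable_comp[OF lebesgue_translation fw])
  have wh: "strongly_measurable lebesgue (\<lambda>s. w (s + h) - w s)" for h
    by (intro strongly_measurable_diff strongly_measurable_simple w
        strongly_measurable_comp[OF lebesgue_translation strongly_measurable_simple[OF w(1)]])
  have wfh: "strongly_measurable lebesgue (\<lambda>s. w (s + h) - f s)" for h
    by (intro strongly_measurable_diff f
        strongly_measurable_comp[OF lebesgue_translation strongly_measurable_simple[OF w(1)]])
  have wf: "strongly_measurable lebesgue (\<lambda>s. w s - f s)"
    by (intro strongly_measurable_diff f strongly_measurable_simple w)
  note meas = strongly_measurable_norm[OF L]
  have eq: "?n (\<lambda>s. f (s + h) - w (s + h)) = ?n (\<lambda>s. f s - w s)" for h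
  proof -
    have "?n (\<lambda>s. f s - w s) = (\<integral>\<^sup>+s. ennreal (norm (f s - w s) powr p) \<partial>distr lebesgue lebesgue (\<lambda>s. s + h))"
      unfolding lebesgue_translation(2) ..
    also have "\<dots> = ?n (\<lambda>s. f (s + h) - w (s + h))"
      using meas[OF fw] by (intro nn_integral_distr lebesgue_translation) (simp add: lebesgue_translation)
    finally show ?thesis by simp
  qed
  have i': "?n (\<lambda>s. f s - w s) \<le> ennreal d" "?n (\<lambda>s. w s - f s) \<le> ennreal d"
    using i by (simp_all only: w_def norm_minus_commute[of "v i _"] less_imp_le)
  have "\<forall>\<^sub>F h in nhds 0. (\<integral>\<^sup>+s. ennreal (norm (w (s + h) - w s) powr p) \<partial>lebesgue) < ennreal d"
    using tendsto_nn_integral_simple_translation_diff[OF w supp(2) p] d by (intro order_tendstoD) auto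
  then show "\<forall>\<^sub>F h in nhds 0. (\<integral>\<^sup>+s. ennreal (norm (f (s + h) - f s) powr p) \<partial>lebesgue) \<le> ennreal e"
  proof eventually_elim
    case (elim h)
    have m: "(\<lambda>s. norm (f s - w s)) \<in> borel_measurable lebesgue"
      "(\<lambda>s. norm (w s - f s)) \<in> borel_measurable lebesgue"
      "(\<lambda>s. norm (f (s + h) - w (s + h))) \<in> borel_measurable lebesgue"
      "(\<lambda>s. norm (w (s + h) - w s)) \<in> borel_measurable lebesgue"
      "(\<lambda>s. norm ((w (s + h) - w s) + (w s - f s))) \<in> borel_measurable lebesgue"
      using meas[OF fw] meas[OF wf] meas[OF fwh] meas[OF wh] meas[OF wfh] by simp_all
    have "?n (\<lambda>s. f (s + h) - f s) = ?n (\<lambda>s. (f (s + h) - w (s + h)) + ((w (s + h) - w s) + (w s - f s)))"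
      by simp
    also have "\<dots> \<le> ennreal k * (?n (\<lambda>s. f (s + h) - w (s + h)) + ?n (\<lambda>s. (w (s + h) - w s) + (w s - f s)))"
      unfolding k_def by (rule nn_integral_norm_add_powr_le[OF _ _ p]) (rule m)+
    also have "\<dots> \<le> ennreal k * (?n (\<lambda>s. f (s + h) - w (s + h))
        + ennreal k * (?n (\<lambda>s. w (s + h) - w s) + ?n (\<lambda>s. w s - f s)))"
      unfolding k_def
      by (intro mult_left_mono add_left_mono nn_integral_norm_add_powr_le[OF _ _ p] m) simp
    also have "\<dots> \<le> ennreal k * (ennreal d + ennreal k * (ennreal d + ennreal d))"
      unfolding eq by (intro mult_left_mono add_mono i' less_imp_le[OF elim]) simp_all
    also have "\<dots> = ennreal (k * (d + k * (d + d)))"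
      using d k by (simp only: ennreal_mult ennreal_plus add_nonneg_nonneg mult_nonneg_nonneg less_imp_le)
    also have "k * (d + k * (d + d)) = e"
    proof -
      have "k * (d + k * (d + d)) = c * d" by (simp add: c_def algebra_simps)
      then show ?thesis using c by (simp add: d_def)
    qed
    finally show ?case .
  qed
qed

text \<open>\<open>f\<close> is only locally integrable, so it is cut off outside the interval
  enlarged by 1 on each side. For \<open>\<bar>h\<bar> < 1\<close> the cutoff is not felt at
  \<open>s\<close> or at \<open>s + h\<close>.\<close>

lemma tendsto_nn_integral_translation_diff_interval:
  fixes f :: "real \<Rightarrow> 'a::banach" and p a b :: real
  assumes f: "f \<in> Lp_loc p" and p: "0 < p"
  shows "((\<lambda>h. \<integral>\<^sup>+s. ennreal (norm (f (s + h) - f s) powr p) \<partial>lebesgue_on {a..b}) \<longlongrightarrow> 0) (nhds 0)"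
proof -
  define S where "S = {a - 1..b + 1}"
  define g where "g s = (if s \<in> S then f s else 0)" for s
  have fm: "strongly_measurable lebesgue f"
    and fin: "(\<integral>\<^sup>+s. ennreal (norm (f s) powr p) \<partial>lebesgue_on S) < \<infinity>"
    using f unfolding Lp_loc_def S_def by auto
  obtain u where u: "\<And>i. simple_function lebesgue (u i)" "AE x in lebesgue. (\<lambda>i. u i x) \<longlonglongrightarrow> f x"
    using fm unfolding strongly_measurable_def by blast
  have g: "strongly_measurable lebesgue g"
    unfolding strongly_measurable_def
  proof (intro exI[of _ "\<lambda>i s. if s \<in> S then u i s else 0"] conjI allI)
    show "simple_function lebesgue (\<lambda>s. if s \<in> S then u i s else 0)" for i
      by (intro simple_function_If u) (auto simp: S_def)
    show "AE x in lebesgue. (\<lambda>i. if x \<in> S then u i x else 0) \<longlonglongrightarrow> g x"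
      using u(2) by eventually_elim (auto simp: g_def)
  qed
  have S: "S \<in> sets lebesgue" "bounded S" by (auto simp: S_def)
  have "(\<integral>\<^sup>+s. ennreal (norm (g s) powr p) \<partial>lebesgue) = (\<integral>\<^sup>+s. ennreal (norm (f s) powr p) \<partial>lebesgue_on S)"
  proof (subst nn_integral_restrict_space)
    have "ennreal (norm (g s) powr p) = ennreal (norm (f s) powr p) * indicator S s" for s
      using p by (simp add: g_def)
    then show "(\<integral>\<^sup>+s. ennreal (norm (g s) powr p) \<partial>lebesgue) = (\<integral>\<^sup>+s. ennreal (norm (f s) powr p) * indicator S s \<partial>lebesgue)"
      by presburger
  qed (use S in simp)
  with fin have lim: "((\<lambda>h. \<integral>\<^sup>+s. ennreal (norm (g (s + h) - g s) powr p) \<partial>lebesgue) \<longlongrightarrow> 0) (nhds 0)"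
    by (intro tendsto_nn_integral_translation_diff[OF g _ S(2) p]) (auto simp: g_def)
  have "\<forall>\<^sub>F h :: real in nhds 0. \<bar>h\<bar> < 1"
    unfolding eventually_nhds_metric by (intro exI[of _ 1]) (auto simp: dist_real_def)
  then have le: "\<forall>\<^sub>F h in nhds 0. (\<integral>\<^sup>+s. ennreal (norm (f (s + h) - f s) powr p) \<partial>lebesgue_on {a..b})
    \<le> (\<integral>\<^sup>+s. ennreal (norm (g (s + h) - g s) powr p) \<partial>lebesgue)"
  proof eventually_elim
    case (elim h)
    have "ennreal (norm (f (s + h) - f s) powr p) * indicator {a..b} s
      \<le> ennreal (norm (g (s + h) - g s) powr p)" for s
    proof (cases "s \<in> {a..b}")
      case True
      then have "s \<in> S" "s + h \<in> S" using elim by (auto simp: S_def)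
      then show ?thesis using True by (simp add: g_def)
    qed simp
    then have "(\<integral>\<^sup>+s. ennreal (norm (f (s + h) - f s) powr p) * indicator {a..b} s \<partial>lebesgue)
      \<le> (\<integral>\<^sup>+s. ennreal (norm (g (s + h) - g s) powr p) \<partial>lebesgue)"
      by (rule nn_integral_mono)
    then show ?case
      by (subst nn_integral_restrict_space) simp_all
  qed
  show ?thesis
    by (rule tendsto_sandwich[OF _ le tendsto_const lim]) auto
qed

subsection \<open>Convolution with a summable operator family\<close>

text \<open>Allows values of \<open>R\<close> at the single point 0 to be ignored. Completeness
  first makes \<open>h\<close> measurable, which the comparison of essential suprema
  requires.\<close>

lemma Lq_norm_cong_AE:
  assumes A: "A \<in> sets lebesgue" and g: "g \<in> borel_measurable (lebesgue_on A)"
    and eq: "AE s in lebesgue_on A. g s = h s"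
  shows "Lq_norm q A g = Lq_norm q A h"
proof -
  interpret complete_measure "lebesgue_on A"
    using A by (rule complete_measure_lebesgue_on)
  have h: "h \<in> borel_measurable (lebesgue_on A)"
    by (rule borel_measurable_AE_eq[OF g]) (use eq in auto)
  have "esssup (lebesgue_on A) (\<lambda>s. ennreal \<bar>g s\<bar>) = esssup (lebesgue_on A) (\<lambda>s. ennreal \<bar>h s\<bar>)"
    using g h eq by (intro esssup_AE_cong) auto
  moreover have "(\<integral>\<^sup>+s. ennreal (\<bar>g s\<bar> powr r) \<partial>lebesgue_on A) = (\<integral>\<^sup>+s. ennreal (\<bar>h s\<bar> powr r) \<partial>lebesgue_on A)" for r
    using eq by (intro nn_integral_cong_AE) auto
  ultimately show ?thesis by (simp add: Lq_norm_def)
qed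

locale summable_Lq_family =
  fixes R :: "real \<Rightarrow> 'a::banach \<Rightarrow>\<^sub>L 'b::banach" and p :: real and q :: ennreal
  assumes p: "1 \<le> p" and conjugate: "1 / ennreal p + 1 / q = 1"
    and strong_cont: "\<And>x. continuous_on {0<..} (\<lambda>t. blinfun_apply (R t) x)"
    and summable_Lq_norm: "(\<Sum>k. Lq_norm q {real k..real k + 1} (\<lambda>s. norm (R s))) < \<infinity>"
begin

definition N :: "nat \<Rightarrow> real" where
  "N k = enn2real (Lq_norm q {real k..real k + 1} (\<lambda>s. norm (R s)))"

lemma N_nonneg: "0 \<le> N k"
  by (simp add: N_def)

text \<open>Each term is bounded by the finite sum of the series, so the \<open>enn2real\<close> in
  \<open>N\<close> loses nothing.\<close>

lemma ennreal_N: "ennreal (N k) = Lq_norm q {real k..real k + 1} (\<lambda>s. norm (R s))"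
proof -
  have "(\<Sum>i\<in>{k}. Lq_norm q {real i..real i + 1} (\<lambda>s. norm (R s)))
    \<le> (\<Sum>i. Lq_norm q {real i..real i + 1} (\<lambda>s. norm (R s)))"
    by (rule sum_le_suminf) auto
  with summable_Lq_norm have "Lq_norm q {real k..real k + 1} (\<lambda>s. norm (R s)) \<noteq> top"
    by (auto simp: top_unique)
  then show ?thesis by (simp add: N_def less_top)
qed

lemma summable_N: "summable N"
  using summable_Lq_norm by (intro summable_suminf_not_top N_nonneg) (simp add: ennreal_N less_top)

lemma summable_N_mult:
  assumes "\<And>k. 0 \<le> c k" "\<And>k. c k \<le> C"
  shows "summable (\<lambda>k. N k * c k)"
proof (rule summable_comparison_test)
  show "summable (\<lambda>k. N k * C)" by (intro summable_mult2 summable_N)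
  show "\<exists>K. \<forall>k\<ge>K. norm (N k * c k) \<le> N k * C"
    using assms N_nonneg by (auto intro!: mult_left_mono simp: abs_mult)
qed

text \<open>Extension by 0 from the positive half-line makes the function Borel on the whole line;
  on the intervals \<open>{real k..real k + 1}\<close> it differs from \<open>norm (R u)\<close> at
  most at 0.\<close>

definition norm_R :: "real \<Rightarrow> real" where
  "norm_R u = (if u > 0 then norm (R u) else 0)"

lemma norm_R_nonneg: "0 \<le> norm_R u"
  by (simp add: norm_R_def)

lemma borel_measurable_norm_R: "norm_R \<in> borel_measurable borel"
  using borel_measurable_norm_strongly_continuous[OF strong_cont] unfolding norm_R_def .

lemma Lq_norm_norm_R: "Lq_norm q {real k..real k + 1} norm_R = ennreal (N k)"
  unfolding ennreal_N
proof (rule Lq_norm_cong_AE)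
  show "norm_R \<in> borel_measurable (lebesgue_on {real k..real k + 1})"
    by (intro measurable_restrict_space1 measurable_completion) (simp add: borel_measurable_norm_R)
  have "AE s in lebesgue. s \<noteq> (0::real)"
    by (intro AE_completion AE_lborel_singleton)
  then have "AE s in lebesgue. s \<in> {real k..real k + 1} \<longrightarrow> norm_R s = norm (R s)"
    by eventually_elim (auto simp: norm_R_def)
  then show "AE s in lebesgue_on {real k..real k + 1}. norm_R s = norm (R s)"
    by (subst AE_restrict_space_iff) auto
qed simp

text \<open>The half-line is cut into the unit intervals ending at \<open>t, t - 1, t - 2, \<dots>\<close>, and
  Hoelder's inequality is applied on each of them.\<close>

lemma nn_integral_convolution_le:
  fixes g :: "real \<Rightarrow> 'a"
  assumes g: "strongly_measurable lebesgue g"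
    and c: "\<And>k. 0 \<le> c k" "\<And>k. c k \<le> C"
    and le: "\<And>k. (\<integral>\<^sup>+s. ennreal (norm (g s) powr p) \<partial>lebesgue_on {t - real k - 1..t - real k - 1 + 1})
      \<le> ennreal (c k powr p)"
  shows "(\<integral>\<^sup>+s. ennreal (norm (R (t - s) (g s))) \<partial>lebesgue_on {..<t}) \<le> ennreal (\<Sum>k. N k * c k)"
proof -
  note L = completion.complete_measure_axioms[of lborel]
  \<comment> \<open>The right endpoint is left unsimplified so that \<open>J k\<close> is literally
    a window \<open>{x..x+1}\<close> of the Stepanov conditions, with
    \<open>x = t - real k - 1\<close>.\<close>
  define J where "J k = {t - real k - 1..t - real k - 1 + 1}" for k
  define h where "h s = ennreal (norm_R (t - s) * norm (g s))" for s
  have gm [measurable]: "(\<lambda>s. norm (g s)) \<in> borel_measurable lebesgue"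
    by (rule strongly_measurable_norm[OF L g])
  have [measurable]: "norm_R \<in> borel_measurable borel" by (rule borel_measurable_norm_R)
  have Rm: "(\<lambda>s. norm_R (t - s)) \<in> borel_measurable lebesgue"
    by (intro measurable_completion) measurable
  have hm: "h \<in> borel_measurable lebesgue"
    unfolding h_def using gm Rm by measurable
  have reflect: "(\<lambda>s. t - s) \<in> lebesgue \<rightarrow>\<^sub>M lebesgue"
    using lebesgue_real_isometry(1)[of "-1" t] by simp
  have J: "J k \<in> sets lebesgue" for k by (simp add: J_def)
  have "(\<integral>\<^sup>+s. ennreal (norm (R (t - s) (g s))) \<partial>lebesgue_on {..<t})
    = (\<integral>\<^sup>+s. ennreal (norm (R (t - s) (g s))) * indicator {..<t} s \<partial>lebesgue)"
    by (rule nn_integral_restrict_space) simp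
  also have "\<dots> \<le> (\<integral>\<^sup>+s. (\<Sum>k. h s * indicator (J k) s) \<partial>lebesgue)"
  proof (rule nn_integral_mono)
    fix s
    show "ennreal (norm (R (t - s) (g s))) * indicator {..<t} s \<le> (\<Sum>k. h s * indicator (J k) s)"
    proof (cases "s < t")
      case True
      \<comment> \<open>The floor selects one interval containing \<open>s\<close>. Neighbouring
        intervals share endpoints, which is harmless for an upper bound.\<close>
      define k where "k = nat \<lfloor>t - s\<rfloor>"
      have "real k = \<lfloor>t - s\<rfloor>" using True by (simp add: k_def)
      then have s: "s \<in> J k" unfolding J_def by simp linarith
      have "ennreal (norm (R (t - s) (g s))) * indicator {..<t} s \<le> h s"
        using True norm_blinfun[of "R (t - s)" "g s"] by (simp add: h_def norm_R_def ennreal_leI)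
      also have "\<dots> = (\<Sum>k\<in>{k}. h s * indicator (J k) s)"
        using s by simp
      also have "\<dots> \<le> (\<Sum>k. h s * indicator (J k) s)"
        by (rule sum_le_suminf) auto
      finally show ?thesis .
    qed simp
  qed
  also have "\<dots> = (\<Sum>k. \<integral>\<^sup>+s. h s * indicator (J k) s \<partial>lebesgue)"
    by (intro nn_integral_suminf borel_measurable_times_ennreal borel_measurable_indicator hm J)
  also have "\<dots> \<le> (\<Sum>k. ennreal (N k * c k))"
  proof (rule suminf_le)
    fix k
    let ?I = "{real k..real k + 1}"
    \<comment> \<open>The reflection \<open>u = t - s\<close> carries \<open>J k\<close> to
      \<open>{real k..real k + 1}\<close>, the interval on which \<open>N k\<close> is the norm of
      \<open>R\<close>.\<close>
    have J_eq: "{t - (real k + 1)..t - real k} = J k" by (simp add: J_def algebra_simps)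
    have "(\<integral>\<^sup>+s. h s * indicator (J k) s \<partial>lebesgue) = (\<integral>\<^sup>+s. h s \<partial>lebesgue_on (J k))"
      using J by (subst nn_integral_restrict_space) auto
    also have "\<dots> = (\<integral>\<^sup>+u. h (t - u) \<partial>lebesgue_on ?I)"
      using nn_integral_lebesgue_on_reflect[OF hm, of "real k" "real k + 1" t] unfolding J_eq by simp
    also have "\<dots> = (\<integral>\<^sup>+u. ennreal (norm_R u * norm (g (t - u))) \<partial>lebesgue_on ?I)"
      by (simp add: h_def)
    also have "\<dots> \<le> ennreal (N k * c k)"
    proof (rule nn_integral_mult_le_Lq_norm[OF p conjugate])
      show "norm_R \<in> borel_measurable (lebesgue_on ?I)"
        by (intro measurable_restrict_space1 measurable_completion) simp
      show "(\<lambda>u. norm (g (t - u))) \<in> borel_measurable (lebesgue_on ?I)"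
        by (intro measurable_restrict_space1 measurable_compose[OF reflect gm])
      have "(\<integral>\<^sup>+u. ennreal (norm (g (t - u)) powr p) \<partial>lebesgue_on ?I)
        = (\<integral>\<^sup>+s. ennreal (norm (g s) powr p) \<partial>lebesgue_on (J k))"
        using nn_integral_lebesgue_on_reflect[of "\<lambda>s. ennreal (norm (g s) powr p)" "real k" "real k + 1" t]
        unfolding J_eq by simp
      then show "(\<integral>\<^sup>+u. ennreal (norm (g (t - u)) powr p) \<partial>lebesgue_on ?I) \<le> ennreal (c k powr p)"
        using le[of k] by (simp add: J_def)
      show "Lq_norm q ?I norm_R = ennreal (N k)" by (rule Lq_norm_norm_R)
    qed (simp_all add: norm_R_nonneg N_nonneg c)
    finally show "(\<integral>\<^sup>+s. h s * indicator (J k) s \<partial>lebesgue) \<le> ennreal (N k * c k)" .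
  qed auto
  also have "\<dots> = ennreal (\<Sum>k. N k * c k)"
    using c by (intro suminf_ennreal2 summable_N_mult[of c C] mult_nonneg_nonneg N_nonneg)
  finally show ?thesis .
qed

lemma strongly_measurable_convolution:
  assumes "strongly_measurable lebesgue g"
  shows "strongly_measurable (lebesgue_on {..<t}) (\<lambda>s. R (t - s) (g s))"
  by (intro strongly_measurable_convolution_integrand strong_cont strongly_measurable_restrict assms) simp

end

section \<open>Convolution with a Stepanov quasi-asymptotically almost periodic function\<close>

locale Stepanov_convolution = summable_Lq_family R p q
  for R :: "real \<Rightarrow> 'a::banach \<Rightarrow>\<^sub>L 'b::banach" and p q +
  fixes f :: "real \<Rightarrow> 'a"
  assumes f: "f \<in> Stepanov_QAAP p"
begin

definition F :: "real \<Rightarrow> 'b" where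
  "F t = bochner_integral (lebesgue_on {..<t}) (\<lambda>s. R (t - s) (f s))"

lemma f_Lp_loc: "f \<in> Lp_loc p"
  using f by (simp add: Stepanov_QAAP_def)

lemma f_measurable: "strongly_measurable lebesgue f"
  using f_Lp_loc by (simp add: Lp_loc_def)

lemma f_translate_measurable: "strongly_measurable lebesgue (\<lambda>s. f (s + h))"
  by (rule strongly_measurable_comp[OF lebesgue_translation f_measurable])

text \<open>The p-th power of the Stepanov norm of \<open>f\<close>; the norm itself is
  \<open>S powr (1 / p)\<close>.\<close>

definition S :: real where
  "S = enn2real (SUP t. \<integral>\<^sup>+s. ennreal (norm (f s) powr p) \<partial>lebesgue_on {t..t+1})"

lemma S_nonneg: "0 \<le> S"
  by (simp add: S_def)

lemma nn_integral_f_le: "(\<integral>\<^sup>+s. ennreal (norm (f s) powr p) \<partial>lebesgue_on {t..t+1}) \<le> ennreal S"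
proof -
  have "(SUP t. \<integral>\<^sup>+s. ennreal (norm (f s) powr p) \<partial>lebesgue_on {t..t+1}) < \<infinity>"
    using f by (simp add: Stepanov_QAAP_def)
  then have eq: "ennreal S = (SUP t. \<integral>\<^sup>+s. ennreal (norm (f s) powr p) \<partial>lebesgue_on {t..t+1})"
    by (simp add: S_def)
  show ?thesis unfolding eq by (rule SUP_upper) simp
qed

text \<open>Bounds the Stepanov distance between \<open>f\<close> and each of its translates: both
  contribute at most \<open>S\<close>, and \<open>2 powr p\<close> comes from splitting the p-th
  power of the difference.\<close>

definition C :: real where
  "C = (2 powr p * (S + S)) powr (1 / p)"

lemma C_nonneg: "0 \<le> C"
  by (simp add: C_def)

lemma nn_integral_f_diff_le:
  "(\<integral>\<^sup>+s. ennreal (norm (f (s + h) - f s) powr p) \<partial>lebesgue_on {t..t+1}) \<le> ennreal (C powr p)"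
proof -
  let ?M = "lebesgue_on {t..t+1}"
  note L = completion.complete_measure_axioms[of lborel]
  have m: "(\<lambda>s. ennreal (norm (f s) powr p)) \<in> borel_measurable lebesgue"
    using strongly_measurable_norm[OF L f_measurable] by measurable
  have "(\<integral>\<^sup>+s. ennreal (norm (f (s + h) + - f s) powr p) \<partial>?M)
    \<le> ennreal (2 powr p) * ((\<integral>\<^sup>+s. ennreal (norm (f (s + h)) powr p) \<partial>?M)
        + (\<integral>\<^sup>+s. ennreal (norm (- f s) powr p) \<partial>?M))"
  proof (rule nn_integral_norm_add_powr_le)
    show "(\<lambda>s. norm (f (s + h))) \<in> borel_measurable ?M"
      by (intro measurable_restrict_space1 strongly_measurable_norm[OF L f_translate_measurable])
    show "(\<lambda>s. norm (- f s)) \<in> borel_measurable ?M"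
      unfolding norm_minus_cancel
      by (intro measurable_restrict_space1 strongly_measurable_norm[OF L f_measurable])
  qed (use p in simp)
  also have "(\<integral>\<^sup>+s. ennreal (norm (f (s + h)) powr p) \<partial>?M)
      = (\<integral>\<^sup>+s. ennreal (norm (f s) powr p) \<partial>lebesgue_on {t + h..t + h + 1})"
    using nn_integral_lebesgue_on_translate[OF m, of t "t + 1" h] by (simp add: add_ac)
  also have "ennreal (2 powr p) * ((\<integral>\<^sup>+s. ennreal (norm (f s) powr p) \<partial>lebesgue_on {t + h..t + h + 1})
        + (\<integral>\<^sup>+s. ennreal (norm (- f s) powr p) \<partial>?M)) \<le> ennreal (2 powr p) * (ennreal S + ennreal S)"
    unfolding norm_minus_cancel by (intro mult_left_mono add_mono nn_integral_f_le) simp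
  also have "\<dots> = ennreal (2 powr p * (S + S))"
    using S_nonneg by (simp only: ennreal_mult ennreal_plus add_nonneg_nonneg powr_ge_zero)
  also have "2 powr p * (S + S) = C powr p"
    using p S_nonneg by (simp add: C_def powr_powr)
  finally show ?thesis by simp
qed

lemma nn_integral_convolution_f_le:
  "(\<integral>\<^sup>+s. ennreal (norm (R (t - s) (f s))) \<partial>lebesgue_on {..<t}) \<le> ennreal (\<Sum>k. N k * S powr (1 / p))"
proof (rule nn_integral_convolution_le[OF f_measurable])
  show "(\<integral>\<^sup>+s. ennreal (norm (f s) powr p) \<partial>lebesgue_on {t - real k - 1..t - real k - 1 + 1})
    \<le> ennreal ((S powr (1 / p)) powr p)" for k
    using nn_integral_f_le[of "t - real k - 1"] p S_nonneg by (simp add: powr_powr)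
qed auto

lemma bochner_integrable_convolution: "bochner_integrable (lebesgue_on {..<t}) (\<lambda>s. R (t - s) (f s))"
proof (rule bochner_integrableI)
  show "(\<integral>\<^sup>+s. ennreal (norm (R (t - s) (f s))) \<partial>lebesgue_on {..<t}) < \<infinity>"
    using nn_integral_convolution_f_le[of t] by (rule le_less_trans) simp
qed (simp_all add: complete_measure_lebesgue_on strongly_measurable_convolution f_measurable)

lemma has_integral_F: "bochner_has_integral (lebesgue_on {..<t}) (\<lambda>s. R (t - s) (f s)) (F t)"
  unfolding F_def by (intro bochner_has_integral_integral complete_measure_lebesgue_on bochner_integrable_convolution) simp

lemma norm_F_le: "norm (F t) \<le> (\<Sum>k. N k * S powr (1 / p))"
proof -
  have "ennreal (norm (F t)) \<le> ennreal (\<Sum>k. N k * S powr (1 / p))"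
    using bochner_has_integral_bound[OF complete_measure_lebesgue_on has_integral_F]
      nn_integral_convolution_f_le by (rule order_trans) simp
  moreover have "0 \<le> (\<Sum>k. N k * S powr (1 / p))"
    by (intro suminf_nonneg summable_mult2 summable_N mult_nonneg_nonneg N_nonneg) simp
  ultimately show ?thesis by simp
qed

lemma has_integral_F_diff:
  "bochner_has_integral (lebesgue_on {..<t}) (\<lambda>s. R (t - s) (f (s + h) - f s)) (F (t + h) - F t)"
proof -
  let ?T = "\<lambda>s. s + h"
  have pre: "?T -` {..<t + h} = {..<t}" by auto
  note T = distr_restrict_space_vimage[OF lebesgue_translation[of h], of "{..<t + h}",
      simplified pre space_completion space_lborel Int_UNIV_right]
  have "bochner_has_integral (lebesgue_on {..<t}) (\<lambda>s. R (t + h - ?T s) (f (?T s))) (F (t + h))"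
    using bochner_has_integral_comp[OF complete_measure_lebesgue_on T has_integral_F[of "t + h"]] by simp
  then have "bochner_has_integral (lebesgue_on {..<t}) (\<lambda>s. R (t - s) (f (s + h))) (F (t + h))"
    by simp
  from bochner_has_integral_diff[OF complete_measure_lebesgue_on this has_integral_F]
  show ?thesis by (simp add: blinfun.diff_right)
qed

lemma norm_F_diff_le:
  assumes c: "\<And>k. 0 \<le> c k" "\<And>k. c k \<le> B"
    and le: "\<And>k. (\<integral>\<^sup>+s. ennreal (norm (f (s + h) - f s) powr p)
      \<partial>lebesgue_on {t - real k - 1..t - real k - 1 + 1}) \<le> ennreal (c k powr p)"
  shows "norm (F (t + h) - F t) \<le> (\<Sum>k. N k * c k)"
proof -
  have "ennreal (norm (F (t + h) - F t)) \<le> (\<integral>\<^sup>+s. ennreal (norm (R (t - s) (f (s + h) - f s))) \<partial>lebesgue_on {..<t})"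
    by (intro bochner_has_integral_bound complete_measure_lebesgue_on has_integral_F_diff) simp
  also have "\<dots> \<le> ennreal (\<Sum>k. N k * c k)"
    by (rule nn_integral_convolution_le[OF _ c le])
      (intro strongly_measurable_diff f_measurable f_translate_measurable)
  finally show ?thesis
    using c by (subst (asm) ennreal_le_iff)
      (auto intro!: suminf_nonneg summable_N_mult[of c B] mult_nonneg_nonneg N_nonneg)
qed

text \<open>Only finitely many unit intervals matter: the remaining ones are absorbed by the tail of
  the series of the norms of \<open>R\<close>. This yields both the continuity and the almost periodicity of \<open>F\<close>.\<close>

lemma norm_F_diff_small:
  assumes e: "0 < e"
  shows "\<exists>K. \<exists>d>0. \<forall>t h. (\<forall>k<K.
      (\<integral>\<^sup>+s. ennreal (norm (f (s + h) - f s) powr p) \<partial>lebesgue_on {t - real k - 1..t - real k - 1 + 1})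
        \<le> ennreal (d powr p)) \<longrightarrow> norm (F (t + h) - F t) \<le> e"
proof -
  define A where "A = suminf N"
  have A: "0 \<le> A" unfolding A_def by (intro suminf_nonneg summable_N N_nonneg)
  \<comment> \<open>The first \<open>K\<close> terms contribute at most
    \<open>A * d \<le> e / 2\<close>. Adding 1 avoids a zero denominator, here and in
    \<open>C + 1\<close> below.\<close>
  define d where "d = e / (2 * (A + 1))"
  have d: "0 < d" using e A by (simp add: d_def)
  \<comment> \<open>\<open>K\<close> is chosen so that the tail of the series, weighted by the
    uniform bound \<open>C\<close>, stays below \<open>e / 2\<close> for every translation.\<close>
  have "0 < e / (2 * (C + 1))" using e C_nonneg by simp
  from suminf_exist_split[OF this summable_N] obtain K where
    "norm (\<Sum>k. N (k + K)) < e / (2 * (C + 1))" by blast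
  then have K: "(\<Sum>k. N (k + K)) * (C + 1) < e / 2"
    using C_nonneg by (simp add: field_simps abs_less_iff)
  have "norm (F (t + h) - F t) \<le> e"
    if le: "\<And>k. k < K \<Longrightarrow> (\<integral>\<^sup>+s. ennreal (norm (f (s + h) - f s) powr p)
      \<partial>lebesgue_on {t - real k - 1..t - real k - 1 + 1}) \<le> ennreal (d powr p)" for t h
  proof -
    define c where "c k = (if k < K then d else C)" for k
    have c: "0 \<le> c k" "c k \<le> max d C" for k
      using d C_nonneg by (auto simp: c_def)
    have "norm (F (t + h) - F t) \<le> (\<Sum>k. N k * c k)"
    proof (rule norm_F_diff_le[OF c])
      show "(\<integral>\<^sup>+s. ennreal (norm (f (s + h) - f s) powr p)
        \<partial>lebesgue_on {t - real k - 1..t - real k - 1 + 1}) \<le> ennreal (c k powr p)" for k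
        using le[of k] nn_integral_f_diff_le[of "t - real k - 1" h] by (simp add: c_def)
    qed
    also have "\<dots> = (\<Sum>k. N (k + K) * c (k + K)) + (\<Sum>k<K. N k * c k)"
      by (rule suminf_split_initial_segment[OF summable_N_mult[OF c]])
    also have "(\<Sum>k. N (k + K) * c (k + K)) = (\<Sum>k. N (k + K)) * C"
      using summable_N by (simp add: c_def suminf_mult2 summable_iff_shift)
    also have "(\<Sum>k<K. N k * c k) = (\<Sum>k<K. N k) * d"
      by (simp add: c_def sum_distrib_right)
    also have "(\<Sum>k<K. N k) * d \<le> A * d"
      unfolding A_def using d by (intro mult_right_mono sum_le_suminf summable_N) (auto simp: N_nonneg)
    also have "A * d \<le> e / 2"
      using A e by (simp add: d_def field_simps)
    also have "(\<Sum>k. N (k + K)) * C \<le> (\<Sum>k. N (k + K)) * (C + 1)"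
      using summable_N by (intro mult_left_mono suminf_nonneg) (auto simp: N_nonneg summable_iff_shift)
    finally show ?thesis using K by simp
  qed
  then show ?thesis using d by blast
qed

text \<open>For fixed \<open>t\<close> only \<open>K\<close> windows have to be small, so finitely
  many neighbourhoods of \<open>h = 0\<close> are intersected. The tolerance \<open>e / 2\<close>
  leaves room for the strict inequality.\<close>

lemma continuous_F: "continuous_on UNIV F"
proof (rule continuous_on_iff[THEN iffD2], intro ballI allI impI)
  fix t e :: real assume "0 < e"
  then obtain K d where d: "0 < d" and small: "\<forall>t h. (\<forall>k<K.
      (\<integral>\<^sup>+s. ennreal (norm (f (s + h) - f s) powr p) \<partial>lebesgue_on {t - real k - 1..t - real k - 1 + 1})
        \<le> ennreal (d powr p)) \<longrightarrow> norm (F (t + h) - F t) \<le> e / 2"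
    using norm_F_diff_small[of "e / 2"] by auto
  have "\<forall>\<^sub>F h in nhds 0. (\<integral>\<^sup>+s. ennreal (norm (f (s + h) - f s) powr p)
    \<partial>lebesgue_on {t - real k - 1..t - real k - 1 + 1}) < ennreal (d powr p)" for k
    by (rule order_tendstoD(2)[OF tendsto_nn_integral_translation_diff_interval[OF f_Lp_loc]])
      (use p d in auto)
  then have "\<forall>\<^sub>F h in nhds 0. \<forall>k\<in>{..<K}. (\<integral>\<^sup>+s. ennreal (norm (f (s + h) - f s) powr p)
    \<partial>lebesgue_on {t - real k - 1..t - real k - 1 + 1}) < ennreal (d powr p)"
    by (intro eventually_ball_finite) auto
  then have "\<forall>\<^sub>F h in nhds 0. norm (F (t + h) - F t) \<le> e / 2"
    by eventually_elim (intro small[rule_format], auto intro: less_imp_le)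
  then obtain r where r: "r > 0" "\<And>h. \<bar>h\<bar> < r \<Longrightarrow> norm (F (t + h) - F t) \<le> e / 2"
    unfolding eventually_nhds_metric by (auto simp: dist_real_def)
  show "\<exists>r>0. \<forall>x'\<in>UNIV. dist x' t < r \<longrightarrow> dist (F x') (F t) < e"
  proof (intro exI[of _ r] conjI ballI impI)
    fix x' assume "dist x' t < r"
    then have "norm (F (t + (x' - t)) - F t) \<le> e / 2"
      by (intro r) (simp add: dist_real_def)
    then show "dist (F x') (F t) < e" using \<open>0 < e\<close> by (simp add: dist_norm)
  qed (rule r)
qed

text \<open>The length \<open>L\<close> and the number \<tau> are those of \<open>f\<close> for the
  tolerance \<open>d\<close>; only the threshold on \<open>\<bar>t\<bar>\<close> grows.\<close>

lemma F_QAAP: "F \<in> QAAP"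
  unfolding QAAP_def
proof (intro CollectI conjI allI impI)
  show "bounded (range F)"
    unfolding bounded_iff using norm_F_le by blast
  show "continuous_on UNIV F" by (rule continuous_F)
  fix e :: real assume "0 < e"
  then obtain K d where d: "0 < d" and small: "\<forall>t h. (\<forall>k<K.
      (\<integral>\<^sup>+s. ennreal (norm (f (s + h) - f s) powr p) \<partial>lebesgue_on {t - real k - 1..t - real k - 1 + 1})
        \<le> ennreal (d powr p)) \<longrightarrow> norm (F (t + h) - F t) \<le> e"
    using norm_F_diff_small[of "e"] by auto
  have "\<exists>L>0. \<forall>J. is_interval J \<and> emeasure lborel J = ennreal L \<longrightarrow>
        (\<exists>\<tau>\<in>J. \<exists>M>0. \<forall>t. \<bar>t\<bar> \<ge> M \<longrightarrow>
           (\<integral>\<^sup>+s. ennreal (norm (f (s + \<tau>) - f s) powr p) \<partial>lebesgue_on {t..t+1})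
             \<le> ennreal (d powr p))"
    using f d by (simp add: Stepanov_QAAP_def)
  then obtain L where L: "L > 0" and per: "\<And>J. is_interval J \<Longrightarrow> emeasure lborel J = ennreal L \<Longrightarrow>
        \<exists>\<tau>\<in>J. \<exists>M>0. \<forall>t. \<bar>t\<bar> \<ge> M \<longrightarrow>
           (\<integral>\<^sup>+s. ennreal (norm (f (s + \<tau>) - f s) powr p) \<partial>lebesgue_on {t..t+1})
             \<le> ennreal (d powr p)"
    by blast
  show "\<exists>L>0. \<forall>J. is_interval J \<and> emeasure lborel J = ennreal L \<longrightarrow>
    (\<exists>\<tau>\<in>J. \<exists>M>0. \<forall>t. \<bar>t\<bar> \<ge> M \<longrightarrow> norm (F (t + \<tau>) - F t) \<le> e)"
  proof (intro exI[of _ L] conjI allI impI, rule L, elim conjE)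
    fix J :: "real set" assume "is_interval J" "emeasure lborel J = ennreal L"
    then obtain \<tau> M where \<tau>: "\<tau> \<in> J" and M: "M > 0"
      and le: "\<And>t. \<bar>t\<bar> \<ge> M \<Longrightarrow>
        (\<integral>\<^sup>+s. ennreal (norm (f (s + \<tau>) - f s) powr p) \<partial>lebesgue_on {t..t+1}) \<le> ennreal (d powr p)"
      using per by blast
    \<comment> \<open>For \<open>k < K\<close> the window starts at \<open>t - real k - 1\<close>,
      at distance at most \<open>real K\<close> from \<open>t\<close>, hence still outside the range
      excluded by \<open>M\<close>.\<close>
    have "norm (F (t + \<tau>) - F t) \<le> e" if "\<bar>t\<bar> \<ge> M + real K + 1" for t
    proof (rule small[rule_format])
      fix k assume "k < K"
      then have "\<bar>t - real k - 1\<bar> \<ge> M" using that by linarith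
      then show "(\<integral>\<^sup>+s. ennreal (norm (f (s + \<tau>) - f s) powr p)
        \<partial>lebesgue_on {t - real k - 1..t - real k - 1 + 1}) \<le> ennreal (d powr p)"
        by (rule le)
    qed
    then show "\<exists>\<tau>\<in>J. \<exists>M>0. \<forall>t. \<bar>t\<bar> \<ge> M \<longrightarrow> norm (F (t + \<tau>) - F t) \<le> e"
      using \<tau> M by (intro bexI[of _ \<tau>] exI[of _ "M + real K + 1"]) auto
  qed
qed

end

text \<open>Integrability is asserted separately because \<open>bochner_integral\<close> takes the
  default value 0 on non-integrable functions. The half-line is open since operators are given only
  for positive arguments; the endpoint has measure 0.\<close>

theorem proposition3p4:
  fixes R :: "real \<Rightarrow> ('a::complex_banach \<Rightarrow>\<^sub>L 'b::complex_banach)"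
    and f :: "real \<Rightarrow> 'a"
    and p :: real and q :: ennreal
  assumes "\<exists>x::'a. x \<noteq> 0" and "\<exists>y::'b. y \<noteq> 0"
    and "1 \<le> p" and "1 / ennreal p + 1 / q = 1"
    and "\<And>t. t > 0 \<Longrightarrow> R t \<in> bounded_clinear_ops"
    and "\<And>x. continuous_on {0<..} (\<lambda>t. blinfun_apply (R t) x)"
    and "(\<Sum>k. Lq_norm q {real k..real k + 1} (\<lambda>s. norm (R s))) < \<infinity>"
    and "f \<in> Stepanov_QAAP p"
  shows "(\<forall>t. bochner_integrable (lebesgue_on {..<t}) (\<lambda>s. blinfun_apply (R (t - s)) (f s))) \<and>
    (\<lambda>t. bochner_integral (lebesgue_on {..<t}) (\<lambda>s. blinfun_apply (R (t - s)) (f s))) \<in> QAAP"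
proof -
  interpret Stepanov_convolution R p q f
    using assms(3,4,6-8) by unfold_locales
  show ?thesis
    using bochner_integrable_convolution F_QAAP unfolding F_def by blast
qed

end
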